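(* Let $p>0$. Then, $\mathbf P$-almost surely, there exists a random $L\in\mathbb Z_{>0}$ such that $$\mathrm G^{\mathbf a,\mathbf b}(m,n)\le \mathcal M^{\mathbf a,\mathbf b}(m,n)+|I_{m,n}^{\mathbf a,\mathbf b}|^{-1}(m+n)^{1/2+p},$$ $$\mathrm G^{\mathbf a,\mathbf b}(m,n)\ge \mathcal M^{\mathbf a,\mathbf b}(m,n)-|I_{m,n}^{\mathbf a,\mathbf b}|^{-1}(m+n)^{9/10+p}$$ for all $m,n\in\mathbb Z_{>0}$ with $m+n\ge L$.
   Context: $[n]=\{1,\dots,n\}$; $\mathrm{Exp}(\lambda)$ is the exponential distribution with rate $\lambda$ (mean $1/\lambda$). Fix two collections of real parameters $\mathbf a=\{\mathbf a_m(i):m\in\mathbb Z_{>0},i\in[m]\}$ and $\mathbf b=\{\mathbf b_n(j):n\in\mathbb Z_{>0},j\in[n]\}$ such that $\mathbf a_m(i)+\mathbf b_n(j)>0$ for all $m,n\in\mathbb Z_{>0}$, $i\in[m]$, $j\in[n]$. Write $\min\mathbf a_m=\min_{i\in[m]}\mathbf a_m(i)$ and $\min\mathbf b_n=\min_{j\in[n]}\mathbf b_n(j)$. Let $(\Omega,\mathbf P)$ be $\Omega=\mathbb R^{\mathbb Z_{>0}^2}$ with the product measure under which the coordinates are i.i.d. $\mathrm{Exp}(1)$. For each $m,n\in\mathbb Z_{>0}$ let $\{\omega_{m,n}^{\mathbf a,\mathbf b}(i,j): i\in[m],j\in[n]\}$ be independent random variables on $(\Omega,\mathbf P)$ with $\omega_{m,n}^{\mathbf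 a,\mathbf b}(i,j)\sim\mathrm{Exp}(\mathbf a_m(i)+\mathbf b_n(j))$; no assumption is made about the joint distribution of these collections for different $(m,n)$. The last-passage time is $$\mathrm G^{\mathbf a,\mathbf b}(m,n)=\max_{\pi}\sum_{(i,j)\in\pi}\omega^{\mathbf a,\mathbf b}_{m,n}(i,j),$$ the maximum over all up-right lattice paths $\pi$ from $(1,1)$ to $(m,n)$ (steps $(1,0)$ or $(0,1)$). For $m,n\in\mathbb Z_{>0}$ let $I_{m,n}^{\mathbf a,\mathbf b}=(-\min\mathbf a_m,\min\mathbf b_n)$, an interval of length $|I_{m,n}^{\mathbf a,\mathbf b}|=\min\mathbf a_m+\min\mathbf b_n>0$, and $$\mathcal M^{\mathbf a,\mathbf b}(m,n)=\inf_{z\in I_{m,n}^{\mathbf a,\mathbf b}}\Big\{\sum_{i=1}^m\frac1{\mathbf a_m(i)+z}+\sum_{j=1}^n\frac1{\mathbf b_n(j)-z}\Big\}.$$ *)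

theory Defs
  imports "HOL-Probability.Probability"
begin

definition exp_measure :: "real \<Rightarrow> real measure" where
  "exp_measure l = density lborel (exponential_density l)"

definition positive_quadrant :: "(nat \<times> nat) set" where
  "positive_quadrant = {1..} \<times> {1..}"

text \<open>The sample space: functions on the positive quadrant (in the sense of \<^const>\<open>PiE\<close>, that is,
  \<^const>\<open>undefined\<close> elsewhere) with i.i.d. rate-one exponential coordinates.\<close>

definition base_measure :: "(nat \<times> nat \<Rightarrow> real) measure" where
  "base_measure = (\<Pi>\<^sub>M ij\<in>positive_quadrant. exp_measure 1)"

text \<open>The parameters are arrays \<open>a m i\<close> and \<open>b n j\<close>, where only the entries with
  \<open>1 \<le> i \<le> m\<close> and \<open>1 \<le> j \<le> n\<close> are meaningful.\<close>

definition admissible :: "(nat \<Rightarrow> nat \<Rightarrow> real) \<Rightarrow> (nat \<Rightarrow> nat \<Rightarrow> real) \<Rightarrow> bool" where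
  "admissible a b \<longleftrightarrow> (\<forall>m\<ge>1. \<forall>n\<ge>1. \<forall>i\<in>{1..m}. \<forall>j\<in>{1..n}. a m i + b n j > 0)"

definition row_min :: "(nat \<Rightarrow> nat \<Rightarrow> real) \<Rightarrow> nat \<Rightarrow> real" where
  "row_min c k = Min (c k ` {1..k})"

text \<open>For each \<open>(m, n)\<close> separately, the weights \<open>\<omega> m n i j\<close> are independent exponentials;
  nothing is required of the joint law for different \<open>(m, n)\<close>.\<close>

definition exponential_weights ::
  "'w measure \<Rightarrow> (nat \<Rightarrow> nat \<Rightarrow> real) \<Rightarrow> (nat \<Rightarrow> nat \<Rightarrow> real)
    \<Rightarrow> (nat \<Rightarrow> nat \<Rightarrow> nat \<Rightarrow> nat \<Rightarrow> 'w \<Rightarrow> real) \<Rightarrow> bool" where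
  "exponential_weights P a b \<omega> \<longleftrightarrow>
    (\<forall>m\<ge>1. \<forall>n\<ge>1.
      prob_space.indep_vars P (\<lambda>_. borel) (\<lambda>(i, j). \<omega> m n i j) ({1..m} \<times> {1..n}) \<and>
      (\<forall>i\<in>{1..m}. \<forall>j\<in>{1..n}.
        distributed P lborel (\<omega> m n i j) (exponential_density (a m i + b n j))))"

definition up_right_step :: "nat \<times> nat \<Rightarrow> nat \<times> nat \<Rightarrow> bool" where
  "up_right_step u v \<longleftrightarrow> v = (fst u + 1, snd u) \<or> v = (fst u, snd u + 1)"

definition up_right_paths :: "nat \<Rightarrow> nat \<Rightarrow> (nat \<times> nat) list set" where
  "up_right_paths m n =
    {\<pi>. \<pi> \<noteq> [] \<and> hd \<pi> = (1, 1) \<and> last \<pi> = (m, n) \<and> successively up_right_step \<pi>}"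

definition last_passage :: "(nat \<Rightarrow> nat \<Rightarrow> real) \<Rightarrow> nat \<Rightarrow> nat \<Rightarrow> real" where
  "last_passage W m n = Max ((\<lambda>\<pi>. \<Sum>(i, j)\<in>set \<pi>. W i j) ` up_right_paths m n)"

definition I_set :: "(nat \<Rightarrow> nat \<Rightarrow> real) \<Rightarrow> (nat \<Rightarrow> nat \<Rightarrow> real) \<Rightarrow> nat \<Rightarrow> nat \<Rightarrow> real set" where
  "I_set a b m n = {- row_min a m <..< row_min b n}"

definition I_length :: "(nat \<Rightarrow> nat \<Rightarrow> real) \<Rightarrow> (nat \<Rightarrow> nat \<Rightarrow> real) \<Rightarrow> nat \<Rightarrow> nat \<Rightarrow> real" where
  "I_length a b m n = row_min a m + row_min b n"

definition M_center :: "(nat \<Rightarrow> nat \<Rightarrow> real) \<Rightarrow> (nat \<Rightarrow> nat \<Rightarrow> real) \<Rightarrow> nat \<Rightarrow> nat \<Rightarrow> real" where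
  "M_center a b m n =
    (INF z\<in>I_set a b m n. (\<Sum>i=1..m. 1 / (a m i + z)) + (\<Sum>j=1..n. 1 / (b n j - z)))"

end

theory Submission
  imports Defs "HOL-Real_Asymp.Real_Asymp"
begin

text \<open>
  Adding to the bulk a boundary row with rates \<open>a i + z\<close> and a boundary column with rates \<open>b j - z\<close>
  makes the model stationary: by Burke's theorem its passage time is a sum of two sums of
  independent exponentials, with mean \<open>F z = (\<Sum>i. 1 / (a i + z)) + (\<Sum>j. 1 / (b j - z))\<close>, so Chernoff
  bounds apply to both. The bulk passage time is at most the stationary one, and at the minimiser of \<open>F\<close>,
  where \<open>(\<Sum>i. 1 / (a i + z)\<^sup>2) = (\<Sum>j. 1 / (b j - z)\<^sup>2)\<close>, the fluctuations are of order
  \<open>sqrt (m + n) / \<bar>I\<bar>\<close>. This is the upper bound.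

  For the lower bound scale to \<open>\<bar>I\<bar> = 1\<close> and write \<open>N = m + n\<close>. If the two sums of squares agree at a
  point \<open>z\<close> at distance at least \<open>N powr (-1/10)\<close> from both ends of \<open>I\<close>, then a stationary path that leaves
  the boundary late is compared with the stationary model with \<open>z\<close> shifted by \<open>N powr (-3/10)\<close>, whose
  passage time is too small. Hence the path leaves the boundary after collecting at most
  \<open>N powr (9/10 + p)\<close>, and removing the boundary costs no more than that. If the sums agree only closer
  to an end of \<open>I\<close>, say to \<open>- min a\<close>, then a path may follow the column \<open>i0\<close> with \<open>a i0 = min a\<close>:
  the columns on either side of \<open>i0\<close> are balanced with a bottom and a top block of rows at
  \<open>z = - min a + N powr (-1/10)\<close>, and column \<open>i0\<close> itself crosses the remaining rows.

  The tails are summable over all \<open>(m, n)\<close>, so the Borel--Cantelli lemma concludes.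
\<close>

section \<open>The last-passage recursion\<close>

text \<open>The first index is the column, the second the row. Index 0 holds the boundary of the
  stationary model; for nonnegative weights with zero boundary the recursion gives the passage time
  from \<open>(1, 1)\<close>.\<close>

fun lpp :: "(nat \<Rightarrow> nat \<Rightarrow> real) \<Rightarrow> nat \<Rightarrow> nat \<Rightarrow> real" where
  "lpp W 0 0 = W 0 0"
| "lpp W (Suc i) 0 = W (Suc i) 0 + lpp W i 0"
| "lpp W 0 (Suc j) = W 0 (Suc j) + lpp W 0 j"
| "lpp W (Suc i) (Suc j) = W (Suc i) (Suc j) + max (lpp W i (Suc j)) (lpp W (Suc i) j)"

declare lpp.simps(4) [simp del]

lemma grid_induct [case_names 1 2 3 4]:
  assumes "P 0 0" "\<And>i. P i 0 \<Longrightarrow> P (Suc i) 0" "\<And>j. P 0 j \<Longrightarrow> P 0 (Suc j)"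
    and "\<And>i j. P i (Suc j) \<Longrightarrow> P (Suc i) j \<Longrightarrow> P (Suc i) (Suc j)"
  shows "P (i :: nat) (j :: nat)"
  using lpp.induct[of "\<lambda>_. P" undefined i j] assms by blast

lemma lpp_mono:
  assumes "\<And>i j. i \<le> m \<Longrightarrow> j \<le> n \<Longrightarrow> W i j \<le> W' i j"
  shows "lpp W m n \<le> lpp W' m n"
  using assms
proof (induction W m n rule: lpp.induct)
  case (4 W i j)
  have "lpp W i (Suc j) \<le> lpp W' i (Suc j)" "lpp W (Suc i) j \<le> lpp W' (Suc i) j"
    "W (Suc i) (Suc j) \<le> W' (Suc i) (Suc j)"
    using 4 by auto
  then show ?case unfolding lpp.simps by (intro add_mono max.mono)
qed (auto intro!: add_mono)

lemma lpp_cong: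
  assumes "\<And>i j. i \<le> m \<Longrightarrow> j \<le> n \<Longrightarrow> W i j = W' i j"
  shows "lpp W m n = lpp W' m n"
  by (intro antisym lpp_mono) (auto simp: assms)

lemma lpp_zero: "lpp (\<lambda>_ _. 0) m n = 0"
  by (induction m n rule: grid_induct) (simp_all add: lpp.simps(4))

lemma lpp_nonneg:
  assumes "\<And>i j. i \<le> m \<Longrightarrow> j \<le> n \<Longrightarrow> 0 \<le> W i j"
  shows "0 \<le> lpp W m n"
  using lpp_mono[of m n "\<lambda>_ _. 0" W] assms by (simp add: lpp_zero)

lemma lpp_scale:
  assumes "c \<ge> 0"
  shows "lpp (\<lambda>i j. c * W i j) m n = c * lpp W m n"
  using assms by (induction m n rule: grid_induct) (simp_all add: lpp.simps(4) distrib_left max_mult_distrib_left)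

lemma lpp_transpose: "lpp (\<lambda>i j. W j i) m n = lpp W n m"
  by (induction m n rule: grid_induct) (simp_all add: lpp.simps(4) max.commute)

lemma lpp_col: "lpp W i 0 = (\<Sum>i'\<le>i. W i' 0)"
  by (induction i) auto

lemma lpp_row: "lpp W 0 j = (\<Sum>j'\<le>j. W 0 j')"
  by (induction j) auto

section \<open>Decomposition of passage times by the exit from the boundary\<close>

lemma max_swap: "max (max a b) (max c d) = max (max a c) (max b (d :: real))"
  by (simp add: ac_simps)

lemma add_max_le_max:
  assumes "a \<le> s + max x y" "b \<le> s + max z w"
  shows "u + max a b \<le> (s :: real) + max (u + max x z) (u + max y w)"
proof -
  have "a \<le> s + max (max x y) (max z w)" "b \<le> s + max (max x y) (max z w)"
    by (rule order_trans[OF assms(1)], simp) (rule order_trans[OF assms(2)], simp)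
  then show ?thesis
    unfolding max_add_distrib_right[symmetric] max_swap[of x z] by simp
qed

text \<open>A path from the origin meets one of the two axes only at the origin, where the weight is
  0, so one of the two modified arrays counts it in full. The induction works because the recursion
  commutes with the maximum of two arrays.\<close>

lemma lpp_split_boundary:
  assumes nonneg: "\<And>i j. 0 \<le> W i j" and "W 0 0 = 0"
  shows "lpp W m n = max (lpp (\<lambda>i j. if i = 0 then 0 else W i j) m n)
                         (lpp (\<lambda>i j. if j = 0 then 0 else W i j) m n)"
proof (induction m n rule: grid_induct)
  case 1
  then show ?case by (simp add: assms)
next
  case (2 i)
  have "lpp (\<lambda>i j. if j = 0 then 0 else W i j) (Suc i) 0 = 0" unfolding lpp_col by simp
  moreover have "lpp (\<lambda>i j. if i = 0 then 0 else W i j) (Suc i) 0 = lpp W (Suc i) 0" 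
    unfolding lpp_col by (intro sum.cong) (auto simp: assms)
  moreover have "0 \<le> lpp W (Suc i) 0" by (intro lpp_nonneg assms)
  ultimately show ?case by linarith
next
  case (3 j)
  have "lpp (\<lambda>i j. if i = 0 then 0 else W i j) 0 (Suc j) = 0" unfolding lpp_row by simp
  moreover have "lpp (\<lambda>i j. if j = 0 then 0 else W i j) 0 (Suc j) = lpp W 0 (Suc j)" 
    unfolding lpp_row by (intro sum.cong) (auto simp: assms)
  moreover have "0 \<le> lpp W 0 (Suc j)" by (intro lpp_nonneg assms)
  ultimately show ?case by linarith
next
  case (4 i j)
  then show ?case
    by (simp only: lpp.simps nat.distinct if_False max_swap flip: max_add_distrib_right)
qed

text \<open>A path runs along \<open>j = 0\<close> and then leaves it. If it leaves at a column at
  most \<open>k\<close>, the prefix sum pays for its boundary part; if it leaves later, the prefix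
  sum pays for everything in the columns up to \<open>k\<close>, all of which lies on the
  boundary.\<close>

lemma lpp_exit_le:
  assumes nonneg: "\<And>i j. 0 \<le> W i j" and zero: "\<And>j. W 0 j = 0"
  shows "lpp W m n \<le> (\<Sum>i\<le>k. W i 0) + max (lpp (\<lambda>i j. if j = 0 then 0 else W i j) m n)
                         (lpp (\<lambda>i j. if i \<le> k then 0 else W i j) m n)"
  (is "_ \<le> ?S + max (lpp ?W0 m n) (lpp ?W1 m n)")
  using assms
proof (induction W m n rule: lpp.induct)
  case (1 W)
  then show ?case by (simp add: sum_nonneg)
next
  case (2 W i)
  let ?W0 = "\<lambda>i j. if j = 0 then 0 else W i j" and ?W1 = "\<lambda>i j. if i \<le> k then 0 else W i j"
  have "lpp W (Suc i) 0 = (\<Sum>i'\<le>Suc i. (if i' \<le> k then W i' 0 else 0) + ?W1 i' 0)"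
    unfolding lpp_col by (intro sum.cong) auto
  also have "\<dots> = (\<Sum>i'\<le>Suc i. (if i' \<le> k then W i' 0 else 0)) + lpp ?W1 (Suc i) 0"
    unfolding lpp_col sum.distrib ..
  also have "(\<Sum>i'\<le>Suc i. (if i' \<le> k then W i' 0 else 0)) = (\<Sum>i' \<in> {..Suc i} \<inter> {..k}. W i' 0)"
    by (subst sum.inter_restrict) auto
  also have "\<dots> \<le> (\<Sum>i'\<le>k. W i' 0)"
    by (intro sum_mono2) (auto simp: 2)
  finally show ?case by simp
next
  case (3 W j)
  have "lpp W 0 (Suc j) = 0" unfolding lpp_row using 3 by simp
  moreover have "0 \<le> (\<Sum>i\<le>k. W i 0)" by (intro sum_nonneg 3)
  moreover have "0 \<le> lpp (\<lambda>i j. if j = 0 then 0 else W i j) 0 (Suc j)"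
    by (intro lpp_nonneg) (auto simp: 3)
  ultimately show ?case by linarith
next
  case (4 W i j)
  let ?W0 = "\<lambda>i j. if j = 0 then 0 else W i j" and ?W1 = "\<lambda>i j. if i \<le> k then 0 else W i j"
  have step: "lpp W (Suc i) (Suc j) \<le> (\<Sum>i\<le>k. W i 0)
      + max (W (Suc i) (Suc j) + max (lpp ?W0 i (Suc j)) (lpp ?W0 (Suc i) j))
            (W (Suc i) (Suc j) + max (lpp ?W1 i (Suc j)) (lpp ?W1 (Suc i) j))"
    unfolding lpp.simps(4) by (intro add_max_le_max "4.IH"[OF "4.prems"])
  have W0: "lpp ?W0 (Suc i) (Suc j) = W (Suc i) (Suc j) + max (lpp ?W0 i (Suc j)) (lpp ?W0 (Suc i) j)"
    by (simp add: lpp.simps(4))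
  show ?case
  proof (cases "Suc i \<le> k")
    \<comment> \<open>In the columns up to \<open>k\<close> the second array vanishes, so its entry
      in \<open>step\<close> is only the weight of the current site, which the first array collects
      anyway.\<close>
    case True
    have z: "lpp ?W1 i' j' = 0" if "i' \<le> k" for i' j'
      using lpp_cong[of i' j' ?W1 "\<lambda>_ _. 0"] that by (simp add: lpp_zero)
    have "0 \<le> lpp ?W0 i (Suc j)"
      by (auto intro!: lpp_nonneg simp: 4)
    then have "W (Suc i) (Suc j) \<le> W (Suc i) (Suc j) + max (lpp ?W0 i (Suc j)) (lpp ?W0 (Suc i) j)"
      by simp
    with step True show ?thesis unfolding W0 z[OF True] z[OF Suc_leD[OF True]]
      by (simp del: lpp.simps add: max.absorb1)
  next
    case False
    then have "lpp ?W1 (Suc i) (Suc j) = W (Suc i) (Suc j) + max (lpp ?W1 i (Suc j)) (lpp ?W1 (Suc i) j)"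
      by (simp add: lpp.simps(4))
    with step show ?thesis unfolding W0 by (simp only:)
  qed
qed

section \<open>Monotonicity and superadditivity of passage times\<close>

lemma lpp_le_up:
  assumes "\<And>i j. 0 \<le> W i j"
  shows "lpp W i j \<le> lpp W i (Suc j)"
proof (cases i)
  case 0
  then show ?thesis using assms[of 0 "Suc j"] by simp
next
  case (Suc i')
  then show ?thesis using assms[of i "Suc j"] by (simp add: lpp.simps(4))
qed

lemma lpp_le_right:
  assumes "\<And>i j. 0 \<le> W i j"
  shows "lpp W i j \<le> lpp W (Suc i) j"
  using lpp_le_up[of "\<lambda>i j. W j i" j i] assms lpp_transpose[of W j i] lpp_transpose[of W j "Suc i"]
  by (simp only:)

text \<open>Join a path in the block up to \<open>(p, q)\<close> to one in the block strictly beyond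
  it. Both blocks are extended by zero to the whole grid, so that a single induction compares them
  with \<open>W\<close>.\<close>

lemma lpp_concat:
  assumes nonneg: "\<And>i j. 0 \<le> W i j"
  shows "lpp (\<lambda>i j. if i \<le> p \<and> j \<le> q then W i j else 0) m n
       + lpp (\<lambda>i j. if i > p \<and> j > q then W i j else 0) m n \<le> lpp W m n"
proof -
  define A where "A = (\<lambda>i j. if i \<le> p \<and> j \<le> q then W i j else 0)"
  define B where "B = (\<lambda>i j. if i > p \<and> j > q then W i j else 0)"
  have Ann: "0 \<le> A i j" for i j by (simp add: A_def nonneg)
  \<comment> \<open>To the right of the lower block its passage time no longer changes, and by
    \<open>A_up\<close> neither does it above the block. Beyond \<open>(p, q)\<close> it is thus a
    constant that passes through the recursion of \<open>B\<close>.\<close>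
  have A_right: "lpp A (Suc i) j = lpp A i j" if "p \<le> i" for i j
  proof (induction j)
    case 0
    then show ?case using that by (simp add: A_def)
  next
    case (Suc j)
    have "lpp A i j \<le> lpp A i (Suc j)"
      by (rule lpp_le_up) (rule Ann)
    moreover have "A (Suc i) (Suc j) = 0" using that by (simp add: A_def)
    ultimately show ?case unfolding lpp.simps(4) Suc by (simp add: max_def)
  qed
  have A_up: "lpp A i (Suc j) = lpp A i j" if "q \<le> j" for i j
  proof (induction i)
    case 0
    then show ?case using that by (simp add: A_def)
  next
    case (Suc i)
    have "lpp A i j \<le> lpp A (Suc i) j"
      by (rule lpp_le_right) (rule Ann)
    moreover have "A (Suc i) (Suc j) = 0" using that by (simp add: A_def)
    ultimately show ?case unfolding lpp.simps(4) Suc by (simp add: max_def)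
  qed
  have B0: "lpp B i j = 0" if "i \<le> p \<or> j \<le> q" for i j
  proof -
    have "lpp B i j = lpp (\<lambda>_ _. 0) i j"
      using that by (intro lpp_cong) (auto simp: B_def)
    then show ?thesis by (simp only: lpp_zero)
  qed
  have A_le: "lpp A i j \<le> lpp W i j" for i j
    by (intro lpp_mono) (auto simp: A_def nonneg)
  have "lpp A m n + lpp B m n \<le> lpp W m n"
  proof (induction m n rule: grid_induct)
    case (4 i j)
    show ?case
    proof (cases "Suc i \<le> p \<or> Suc j \<le> q")
      case True
      then show ?thesis using B0[of "Suc i" "Suc j"] A_le[of "Suc i" "Suc j"] by simp
    next
      case False
      then have A: "lpp A (Suc i) (Suc j) = lpp A i (Suc j)" "lpp A (Suc i) j = lpp A i (Suc j)"
        and B: "B (Suc i) (Suc j) = W (Suc i) (Suc j)"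
        using A_right[of i "Suc j"] A_up[of j "Suc i"] by (auto simp: B_def)
      have "lpp A (Suc i) (Suc j) + lpp B (Suc i) (Suc j) = W (Suc i) (Suc j)
          + max (lpp A i (Suc j) + lpp B i (Suc j)) (lpp A (Suc i) j + lpp B (Suc i) j)"
        unfolding lpp.simps(4)[of B] A B max_add_distrib_right[symmetric] by (rule add.left_commute)
      also have "\<dots> \<le> lpp W (Suc i) (Suc j)"
        unfolding lpp.simps(4) by (intro add_left_mono max.mono 4)
      finally show ?thesis .
    qed
  next
    case 1
    show ?case using B0[of 0 0] A_le[of 0 0] by linarith
  next
    case (2 i)
    show ?case using B0[of "Suc i" 0] A_le[of "Suc i" 0] by linarith
  next
    case (3 j)
    show ?case using B0[of 0 "Suc j"] A_le[of 0 "Suc j"] by linarith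
  qed
  then show ?thesis unfolding A_def B_def .
qed

section \<open>The involution behind Burke's theorem\<close>

lemma prob_space_exp_measure: "l > 0 \<Longrightarrow> prob_space (exp_measure l)"
  unfolding exp_measure_def by (rule prob_space_exponential_density)

lemma sets_exp_measure [simp, measurable_cong]: "sets (exp_measure l) = sets borel"
  by (simp add: exp_measure_def)

lemma space_exp_measure [simp]: "space (exp_measure l) = UNIV"
  by (simp add: exp_measure_def)

lemma nn_integral_exp_measure:
  assumes "f \<in> borel_measurable borel"
  shows "(\<integral>\<^sup>+x. f x \<partial>exp_measure l) = (\<integral>\<^sup>+x. ennreal (exponential_density l x) * f x \<partial>lborel)"
  unfolding exp_measure_def using assms by (subst nn_integral_density) auto

text \<open>Lets every rate be realised on one rate-one space: \<open>x / l\<close> has rate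
  \<open>l\<close>, by an affine substitution.\<close>

lemma nn_integral_exp_measure_scale:
  assumes [measurable]: "f \<in> borel_measurable borel" and l: "l > 0"
  shows "(\<integral>\<^sup>+x. f (x / l) \<partial>exp_measure 1) = (\<integral>\<^sup>+x. f x \<partial>exp_measure l)"
proof -
  have "(\<integral>\<^sup>+x. f (x / l) \<partial>exp_measure 1)
      = ennreal l * (\<integral>\<^sup>+x. ennreal (exponential_density 1 (l * x)) * f x \<partial>lborel)"
    using l by (subst nn_integral_exp_measure, measurable)
      (subst nn_integral_real_affine[where c = l and t = 0], auto)
  also have "\<dots> = (\<integral>\<^sup>+x. ennreal (exponential_density l x) * f x \<partial>lborel)"
    using l by (subst nn_integral_cmult[symmetric], measurable)
      (auto intro!: nn_integral_cong
        simp: exponential_density_def ennreal_mult mult_less_0_iff ac_simps)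
  finally show ?thesis by (simp add: nn_integral_exp_measure)
qed

text \<open>Splitting along the diagonal \<open>u = v\<close> and passing to the coordinates \<open>min u v\<close> and
  \<open>\<bar>u - v\<bar>\<close> turns the involution of Burke's theorem into an exchange of two integration variables.\<close>

lemma nn_integral_split_diagonal:
  fixes F :: "real \<times> real \<times> real \<Rightarrow> ennreal"
  assumes [measurable]: "F \<in> borel_measurable (borel \<Otimes>\<^sub>M borel \<Otimes>\<^sub>M borel)"
  shows "(\<integral>\<^sup>+u. \<integral>\<^sup>+v. \<integral>\<^sup>+w. F (u, v, w) \<partial>lborel \<partial>lborel \<partial>lborel)
    = (\<integral>\<^sup>+v. \<integral>\<^sup>+w. \<integral>\<^sup>+s. indicator {0..} s * F (v + s, v, w) \<partial>lborel \<partial>lborel \<partial>lborel)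
    + (\<integral>\<^sup>+u. \<integral>\<^sup>+w. \<integral>\<^sup>+s. indicator {0<..} s * F (u, u + s, w) \<partial>lborel \<partial>lborel \<partial>lborel)"
proof -
  define g where "g u v = (\<integral>\<^sup>+w. F (u, v, w) \<partial>lborel)" for u v
  have [measurable]: "(\<lambda>x. g (f x) (h x)) \<in> borel_measurable M"
    if [measurable]: "f \<in> borel_measurable M" "h \<in> borel_measurable M" for f h and M :: "'b measure"
    unfolding g_def by measurable
  have "(\<integral>\<^sup>+u. \<integral>\<^sup>+v. g u v \<partial>lborel \<partial>lborel)
      = (\<integral>\<^sup>+u. \<integral>\<^sup>+v. indicator {v..} u * g u v + indicator {u<..} v * g u v \<partial>lborel \<partial>lborel)"
    by (intro nn_integral_cong) (auto simp: indicator_def)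
  also have "\<dots> = (\<integral>\<^sup>+u. \<integral>\<^sup>+v. indicator {v..} u * g u v \<partial>lborel \<partial>lborel)
      + (\<integral>\<^sup>+u. \<integral>\<^sup>+v. indicator {u<..} v * g u v \<partial>lborel \<partial>lborel)"
    by (simp add: nn_integral_add indicator_def)
  also have "(\<integral>\<^sup>+u. \<integral>\<^sup>+v. indicator {v..} u * g u v \<partial>lborel \<partial>lborel)
      = (\<integral>\<^sup>+v. \<integral>\<^sup>+u. indicator {v..} u * g u v \<partial>lborel \<partial>lborel)"
    by (rule lborel_pair.Fubini'[symmetric]) (simp add: indicator_def split_beta')
  also have "\<dots> = (\<integral>\<^sup>+v. \<integral>\<^sup>+s. indicator {0..} s * g (v + s) v \<partial>lborel \<partial>lborel)"
    by (rule nn_integral_cong, rename_tac v, subst nn_integral_real_affine[where c = 1 and t = v for v])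
      (auto simp: indicator_def intro!: nn_integral_cong)
  also have "\<dots> = (\<integral>\<^sup>+v. \<integral>\<^sup>+s. \<integral>\<^sup>+w. indicator {0..} s * F (v + s, v, w) \<partial>lborel \<partial>lborel \<partial>lborel)"
    unfolding g_def by (simp add: nn_integral_cmult)
  also have "\<dots> = (\<integral>\<^sup>+v. \<integral>\<^sup>+w. \<integral>\<^sup>+s. indicator {0..} s * F (v + s, v, w) \<partial>lborel \<partial>lborel \<partial>lborel)"
    by (intro nn_integral_cong lborel_pair.Fubini') (simp add: split_beta')
  also have "(\<integral>\<^sup>+u. \<integral>\<^sup>+v. indicator {u<..} v * g u v \<partial>lborel \<partial>lborel)
      = (\<integral>\<^sup>+u. \<integral>\<^sup>+s. indicator {0<..} s * g u (u + s) \<partial>lborel \<partial>lborel)"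
    by (rule nn_integral_cong, rename_tac u, subst nn_integral_real_affine[where c = 1 and t = u for u])
      (auto simp: indicator_def intro!: nn_integral_cong)
  also have "\<dots> = (\<integral>\<^sup>+u. \<integral>\<^sup>+s. \<integral>\<^sup>+w. indicator {0<..} s * F (u, u + s, w) \<partial>lborel \<partial>lborel \<partial>lborel)"
    unfolding g_def by (simp add: nn_integral_cmult)
  also have "\<dots> = (\<integral>\<^sup>+u. \<integral>\<^sup>+w. \<integral>\<^sup>+s. indicator {0<..} s * F (u, u + s, w) \<partial>lborel \<partial>lborel \<partial>lborel)"
    by (intro nn_integral_cong lborel_pair.Fubini') (simp add: split_beta')
  finally show ?thesis unfolding g_def .
qed

text \<open>On \<open>u = v + s\<close> with \<open>s >= 0\<close> the map sends
  \<open>(v + s, v, w)\<close> to \<open>(w + s, w, v)\<close>, so it only exchanges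
  \<open>v\<close> and \<open>w\<close>; the other side of the diagonal is symmetric. Fubini then
  undoes the exchange.\<close>

lemma nn_integral_burke_lborel:
  fixes F :: "real \<times> real \<times> real \<Rightarrow> ennreal" and p q :: real
  assumes F [measurable]: "F \<in> borel_measurable (borel \<Otimes>\<^sub>M borel \<Otimes>\<^sub>M borel)"
    and pq: "p > 0" "q > 0"
  defines "d \<equiv> \<lambda>(u, v, w). ennreal (exponential_density p u) *
    (ennreal (exponential_density q v) * ennreal (exponential_density (p + q) w))"
  shows "(\<integral>\<^sup>+u. \<integral>\<^sup>+v. \<integral>\<^sup>+w. d (u, v, w) * F (w + max 0 (u - v), w + max 0 (v - u), min u v)
      \<partial>lborel \<partial>lborel \<partial>lborel)
    = (\<integral>\<^sup>+u. \<integral>\<^sup>+v. \<integral>\<^sup>+w. d (u, v, w) * F (u, v, w) \<partial>lborel \<partial>lborel \<partial>lborel)"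
proof -
  have [measurable]: "d \<in> borel_measurable (borel \<Otimes>\<^sub>M borel \<Otimes>\<^sub>M borel)"
    unfolding d_def by measurable
  have d_eq: "d (u, v, w) = ennreal (if 0 \<le> u \<and> 0 \<le> v \<and> 0 \<le> w
      then p * q * (p + q) * exp (- (p * u + q * v + (p + q) * w)) else 0)" for u v w
  proof -
    have "exp (- (p * u + q * v + (p + q) * w)) = exp (- u * p) * (exp (- v * q) * exp (- w * (p + q)))"
      by (simp add: exp_add[symmetric] algebra_simps)
    then show ?thesis
      using pq by (auto simp: d_def exponential_density_def ennreal_mult[symmetric] ac_simps)
  qed
  \<comment> \<open>Here the third rate has to be \<open>p + q\<close>: the exponent becomes
    \<open>p * s + (p + q) * (v + w)\<close>, or \<open>q * s + (p + q) * (v + w)\<close> in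
    \<open>d2\<close>, which is symmetric in \<open>v\<close> and \<open>w\<close>.\<close>
  have d1: "d (v + s, v, w) = d (w + s, w, v)" and d2: "d (v, v + s, w) = d (w, w + s, v)"
    if "s \<ge> 0" for v w s
    using that by (auto simp: d_eq algebra_simps)
  have "(\<integral>\<^sup>+v. \<integral>\<^sup>+w. \<integral>\<^sup>+s. indicator {0..} s * (d (v + s, v, w) * F (w + max 0 (v + s - v),
          w + max 0 (v - (v + s)), min (v + s) v)) \<partial>lborel \<partial>lborel \<partial>lborel)
      = (\<integral>\<^sup>+v. \<integral>\<^sup>+w. \<integral>\<^sup>+s. indicator {0..} s * (d (w + s, w, v) * F (w + s, w, v))
          \<partial>lborel \<partial>lborel \<partial>lborel)"
    by (intro nn_integral_cong) (auto simp: indicator_def d1)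
  also have "\<dots> = (\<integral>\<^sup>+w. \<integral>\<^sup>+v. \<integral>\<^sup>+s. indicator {0..} s * (d (w + s, w, v) * F (w + s, w, v))
          \<partial>lborel \<partial>lborel \<partial>lborel)"
    by (rule lborel_pair.Fubini') (simp add: split_beta')
  finally have 1: "(\<integral>\<^sup>+v. \<integral>\<^sup>+w. \<integral>\<^sup>+s. indicator {0..} s * (d (v + s, v, w) * F (w + max 0 (v + s - v),
          w + max 0 (v - (v + s)), min (v + s) v)) \<partial>lborel \<partial>lborel \<partial>lborel) = \<dots>" .
  have "(\<integral>\<^sup>+v. \<integral>\<^sup>+w. \<integral>\<^sup>+s. indicator {0<..} s * (d (v, v + s, w) * F (w + max 0 (v - (v + s)),
          w + max 0 (v + s - v), min v (v + s))) \<partial>lborel \<partial>lborel \<partial>lborel)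
      = (\<integral>\<^sup>+v. \<integral>\<^sup>+w. \<integral>\<^sup>+s. indicator {0<..} s * (d (w, w + s, v) * F (w, w + s, v))
          \<partial>lborel \<partial>lborel \<partial>lborel)"
    by (intro nn_integral_cong) (auto simp: indicator_def d2)
  also have "\<dots> = (\<integral>\<^sup>+w. \<integral>\<^sup>+v. \<integral>\<^sup>+s. indicator {0<..} s * (d (w, w + s, v) * F (w, w + s, v))
          \<partial>lborel \<partial>lborel \<partial>lborel)"
    by (rule lborel_pair.Fubini') (simp add: split_beta')
  finally have 2: "(\<integral>\<^sup>+v. \<integral>\<^sup>+w. \<integral>\<^sup>+s. indicator {0<..} s * (d (v, v + s, w) * F (w + max 0 (v - (v + s)),
          w + max 0 (v + s - v), min v (v + s))) \<partial>lborel \<partial>lborel \<partial>lborel) = \<dots>" .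
  show ?thesis
    using nn_integral_split_diagonal[of "\<lambda>(u, v, w). d (u, v, w) * F (w + max 0 (u - v), w + max 0 (v - u), min u v)"]
      nn_integral_split_diagonal[of "\<lambda>x. d x * F x"]
    unfolding prod.case 1 2 by simp
qed

text \<open>Scaling the three coordinates to rate one brings the invariance into the form in which
  it acts on a product of identical measures.\<close>

lemma nn_integral_burke:
  fixes F :: "real \<times> real \<times> real \<Rightarrow> ennreal"
  assumes F [measurable]: "F \<in> borel_measurable (borel \<Otimes>\<^sub>M borel \<Otimes>\<^sub>M borel)"
    and pq: "p > 0" "q > 0"
  shows "(\<integral>\<^sup>+u. \<integral>\<^sup>+v. \<integral>\<^sup>+w. F (p * (w / (p + q) + max 0 (u / p - v / q)),
      q * (w / (p + q) + max 0 (v / q - u / p)), (p + q) * min (u / p) (v / q))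
      \<partial>exp_measure 1 \<partial>exp_measure 1 \<partial>exp_measure 1)
    = (\<integral>\<^sup>+u. \<integral>\<^sup>+v. \<integral>\<^sup>+w. F (u, v, w) \<partial>exp_measure 1 \<partial>exp_measure 1 \<partial>exp_measure 1)"
proof -
  have scale: "(\<integral>\<^sup>+u. \<integral>\<^sup>+v. \<integral>\<^sup>+w. G (u / p, v / q, w / (p + q)) \<partial>exp_measure 1 \<partial>exp_measure 1 \<partial>exp_measure 1)
    = (\<integral>\<^sup>+u. \<integral>\<^sup>+v. \<integral>\<^sup>+w. ennreal (exponential_density p u) * (ennreal (exponential_density q v) *
        ennreal (exponential_density (p + q) w)) * G (u, v, w) \<partial>lborel \<partial>lborel \<partial>lborel)"
    if [measurable]: "G \<in> borel_measurable (borel \<Otimes>\<^sub>M borel \<Otimes>\<^sub>M borel)" for G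
  proof -
    interpret e1: prob_space "exp_measure 1" by (rule prob_space_exp_measure) simp
    interpret ep: prob_space "exp_measure p" by (rule prob_space_exp_measure) (rule pq)
    interpret eq: prob_space "exp_measure q" by (rule prob_space_exp_measure) (rule pq)
    interpret epq: prob_space "exp_measure (p + q)" by (rule prob_space_exp_measure) (use pq in simp)
    have "(\<integral>\<^sup>+u. \<integral>\<^sup>+v. \<integral>\<^sup>+w. G (u / p, v / q, w / (p + q)) \<partial>exp_measure 1 \<partial>exp_measure 1 \<partial>exp_measure 1)
        = (\<integral>\<^sup>+u. \<integral>\<^sup>+v. \<integral>\<^sup>+w. G (u / p, v / q, w) \<partial>exp_measure (p + q) \<partial>exp_measure 1 \<partial>exp_measure 1)"
      using pq by (intro nn_integral_cong nn_integral_exp_measure_scale) auto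
    also have "\<dots> = (\<integral>\<^sup>+u. \<integral>\<^sup>+v. \<integral>\<^sup>+w. G (u / p, v, w) \<partial>exp_measure (p + q) \<partial>exp_measure q \<partial>exp_measure 1)"
      using pq by (intro nn_integral_cong nn_integral_exp_measure_scale[where f = "\<lambda>v. \<integral>\<^sup>+w. G (_, v, w) \<partial>_"]) auto
    also have "\<dots> = (\<integral>\<^sup>+u. \<integral>\<^sup>+v. \<integral>\<^sup>+w. G (u, v, w) \<partial>exp_measure (p + q) \<partial>exp_measure q \<partial>exp_measure p)"
      using pq by (intro nn_integral_exp_measure_scale[where f = "\<lambda>u. \<integral>\<^sup>+v. \<integral>\<^sup>+w. G (u, v, w) \<partial>_ \<partial>_"]) auto
    finally show ?thesis
      by (simp add: nn_integral_exp_measure nn_integral_cmult[symmetric] mult.assoc)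
  qed
  define G where "G = (\<lambda>(u, v, w). F (p * u, q * v, (p + q) * w))"
  have [measurable]: "G \<in> borel_measurable (borel \<Otimes>\<^sub>M borel \<Otimes>\<^sub>M borel)"
    unfolding G_def by measurable
  show ?thesis
    using scale[of "\<lambda>(u, v, w). G (w + max 0 (u - v), w + max 0 (v - u), min u v)"] scale[of G]
      nn_integral_burke_lborel[of G p q] pq add_pos_pos[OF pq, THEN less_imp_neq]
    by (simp add: G_def)
qed

section \<open>Deviations of sums of independent exponentials\<close>

text \<open>Stating bounds through a measurable exceptional set avoids proving measurability of each event.\<close>

definition holds_except :: "'a measure \<Rightarrow> real \<Rightarrow> ('a \<Rightarrow> bool) \<Rightarrow> bool" where
  "holds_except M e P \<longleftrightarrow> (\<exists>B\<in>sets M. measure M B \<le> e \<and> (\<forall>x\<in>space M. x \<notin> B \<longrightarrow> P x))"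

lemma holds_except_mono:
  assumes "holds_except M e P" "e \<le> e'" "\<And>x. x \<in> space M \<Longrightarrow> P x \<Longrightarrow> Q x"
  shows "holds_except M e' Q"
  using assms unfolding holds_except_def by (meson order_trans)

lemma holds_except_conj:
  assumes "finite_measure M" "holds_except M e P" "holds_except M f Q"
  shows "holds_except M (e + f) (\<lambda>x. P x \<and> Q x)"
proof -
  interpret finite_measure M by fact
  from assms(2,3) obtain A B where "A \<in> sets M" "measure M A \<le> e" "\<forall>x\<in>space M. x \<notin> A \<longrightarrow> P x"
    "B \<in> sets M" "measure M B \<le> f" "\<forall>x\<in>space M. x \<notin> B \<longrightarrow> Q x"
    unfolding holds_except_def by blast
  moreover from this have "measure M (A \<union> B) \<le> e + f"
    using measure_subadditive[of A M B] by simp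
  ultimately show ?thesis
    unfolding holds_except_def by (intro bexI[of _ "A \<union> B"]) auto
qed

lemma holds_except_AE:
  assumes "AE x in M. P x"
  shows "holds_except M 0 P"
proof -
  from AE_E[OF assms] obtain B where "{x \<in> space M. \<not> P x} \<subseteq> B" "emeasure M B = 0" "B \<in> sets M" .
  then show ?thesis unfolding holds_except_def by (intro bexI[of _ B]) (auto simp: measure_def)
qed

lemma holds_except_vimage:
  assumes "T \<in> measurable M M'" "distr M M' T = M'" "holds_except M' e P"
  shows "holds_except M e (\<lambda>x. P (T x))"
proof -
  from assms(3) obtain B where B: "B \<in> sets M'" "measure M' B \<le> e" "\<forall>x\<in>space M'. x \<notin> B \<longrightarrow> P x"
    unfolding holds_except_def by blast
  have "measure M (T -` B \<inter> space M) = measure (distr M M' T) B"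
    using assms(1) B(1) by (simp add: measure_distr)
  then show ?thesis
    unfolding holds_except_def using B assms(1,2)
    by (intro bexI[of _ "T -` B \<inter> space M"]) (auto simp: measurable_space measurable_sets)
qed

text \<open>Tilting by \<open>exp (s * x)\<close> gives a multiple of the density of rate
  \<open>1 - s\<close>, hence the value \<open>exp (- s) / (1 - s)\<close>; a quadratic bound on
  \<open>ln (1 - s)\<close> for small \<open>s\<close> does the rest.\<close>

lemma nn_integral_exp_measure_exp:
  assumes "\<bar>s\<bar> \<le> 1/2"
  shows "(\<integral>\<^sup>+x. ennreal (exp (s * (x - 1))) \<partial>exp_measure 1) \<le> ennreal (exp (2 * s\<^sup>2))"
proof -
  have s: "0 < 1 - s" using assms by linarith
  interpret e: prob_space "density lborel (exponential_density (1 - s))"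
    by (rule prob_space_exponential_density) fact
  have "(\<integral>\<^sup>+x. ennreal (exp (s * (x - 1))) \<partial>exp_measure 1)
      = (\<integral>\<^sup>+x. ennreal (exp (- s) / (1 - s)) * ennreal (exponential_density (1 - s) x) \<partial>lborel)"
  proof (subst nn_integral_exp_measure, measurable, intro nn_integral_cong)
    fix x :: real
    have "exp (- x) * exp (s * (x - 1)) = exp (- s) * exp (- x * (1 - s))"
      by (simp add: mult_exp_exp algebra_simps)
    also have "\<dots> = exp (- s) / (1 - s) * ((1 - s) * exp (- x * (1 - s)))"
      using s by simp
    finally show "ennreal (exponential_density 1 x) * ennreal (exp (s * (x - 1)))
        = ennreal (exp (- s) / (1 - s)) * ennreal (exponential_density (1 - s) x)"
      using s by (auto simp: exponential_density_def ennreal_mult[symmetric])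
  qed
  also have "\<dots> = ennreal (exp (- s) / (1 - s)) * emeasure (density lborel (exponential_density (1 - s))) UNIV"
    by (subst nn_integral_cmult) (auto simp: emeasure_density)
  also have "\<dots> = ennreal (exp (- s) / (1 - s))"
    using e.emeasure_space_1 by simp
  also have "exp (- s) / (1 - s) = exp (- s - ln (1 - s))"
    using s by (simp add: exp_diff)
  also have "\<dots> \<le> exp (2 * s\<^sup>2)"
    using abs_ln_one_plus_x_minus_x_bound[of "- s"] assms by simp
  finally show ?thesis by (simp add: ennreal_leI)
qed

text \<open>Chernoff bound: Markov's inequality for the exponential of the sum, whose integral
  factorises over the product measure.\<close>

lemma exponential_sum_tail:
  fixes c :: "'k \<Rightarrow> real"
  assumes K: "finite K" "S \<subseteq> K" and c: "\<And>k. k \<in> S \<Longrightarrow> \<bar>c k\<bar> \<le> 1/2"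
  defines "M \<equiv> PiM K (\<lambda>_. exp_measure 1)"
  shows "measure M {x \<in> space M. t \<le> (\<Sum>k\<in>S. c k * (x k - 1))} \<le> exp (2 * (\<Sum>k\<in>S. (c k)\<^sup>2) - t)"
proof -
  interpret e: prob_space "exp_measure 1" by (rule prob_space_exp_measure) simp
  interpret P: product_sigma_finite "\<lambda>_::'k. exp_measure 1" ..
  interpret M: prob_space M unfolding M_def by (rule prob_space_PiM) (rule e.prob_space_axioms)
  have meas_factor: "(\<lambda>y. ennreal (if k \<in> S then exp (c k * (y - 1)) else 1)) \<in> borel_measurable (exp_measure 1)" for k
    by (cases "k \<in> S") simp_all
  have meas [measurable]: "(\<lambda>x. x k) \<in> borel_measurable M" if "k \<in> K" for k
    unfolding M_def using measurable_component_singleton[OF that, of "\<lambda>_. exp_measure 1"]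
    by (simp cong: measurable_cong_sets)
  \<comment> \<open>The factor 1 outside \<open>S\<close> turns the integrand into a product over
    all of \<open>K\<close>.\<close>
  define u where "u x = ennreal (\<Prod>k\<in>K. if k \<in> S then exp (c k * (x k - 1)) else 1)" for x
  have u: "u x = ennreal (exp (\<Sum>k\<in>S. c k * (x k - 1)))" for x
    unfolding u_def using K finite_subset[OF K(2,1)]
    by (simp add: exp_sum prod.If_cases Int_absorb1)
  have [measurable]: "u \<in> borel_measurable M"
    unfolding u_def by measurable
  have "emeasure M {x \<in> space M. t \<le> (\<Sum>k\<in>S. c k * (x k - 1))}
      = emeasure M ({x \<in> space M. 1 \<le> ennreal (exp (- t)) * u x})"
    by (intro arg_cong[of _ _ "emeasure M"])
      (auto simp: u ennreal_mult[symmetric] mult_exp_exp)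
  also have "\<dots> \<le> ennreal (exp (- t)) * (\<integral>\<^sup>+x. u x * indicator (space M) x \<partial>M)"
    using nn_integral_Markov_inequality[of u "space M" M "ennreal (exp (- t))"] by simp
  also have "(\<integral>\<^sup>+x. u x * indicator (space M) x \<partial>M) = (\<integral>\<^sup>+x. u x \<partial>M)"
    by (intro nn_integral_cong) simp
  also have "\<dots> = (\<integral>\<^sup>+x. (\<Prod>k\<in>K. ennreal (if k \<in> S then exp (c k * (x k - 1)) else 1)) \<partial>M)"
    unfolding u_def by (intro nn_integral_cong prod_ennreal[symmetric]) auto
  also have "\<dots> = (\<Prod>k\<in>K. \<integral>\<^sup>+y. ennreal (if k \<in> S then exp (c k * (y - 1)) else 1) \<partial>exp_measure 1)"
    unfolding M_def by (rule P.product_nn_integral_prod[OF K(1)]) (rule meas_factor)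
  also have "\<dots> \<le> (\<Prod>k\<in>K. ennreal (if k \<in> S then exp (2 * (c k)\<^sup>2) else 1))"
    using c e.emeasure_space_1
    by (intro prod_mono_ennreal) (auto intro!: nn_integral_exp_measure_exp)
  also have "\<dots> = ennreal (exp (\<Sum>k\<in>S. 2 * (c k)\<^sup>2))"
    using K finite_subset[OF K(2,1)]
    by (subst prod_ennreal) (auto simp: exp_sum prod.If_cases Int_absorb1)
  finally have "emeasure M {x \<in> space M. t \<le> (\<Sum>k\<in>S. c k * (x k - 1))}
      \<le> ennreal (exp (2 * (\<Sum>k\<in>S. (c k)\<^sup>2) - t))"
    by (simp add: mult_left_mono ennreal_mult[symmetric] mult_exp_exp sum_distrib_left)
  then show ?thesis
    by (simp add: M.emeasure_eq_measure)
qed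

text \<open>Chernoff bound with one fixed parameter, applied to \<open>c\<close> and to
  \<open>- c\<close>. The tail is only exponential in \<open>t / sqrt V\<close>, which is enough for
  summability.\<close>

lemma exponential_sum_deviation:
  fixes c :: "'k \<Rightarrow> real"
  assumes K: "finite K" "S \<subseteq> K" and V: "(\<Sum>k\<in>S. (c k)\<^sup>2) \<le> V" "V > 0"
  shows "holds_except (PiM K (\<lambda>_. exp_measure 1)) (4 * exp (- t / (2 * sqrt V)))
    (\<lambda>x. \<bar>(\<Sum>k\<in>S. c k * x k) - (\<Sum>k\<in>S. c k)\<bar> \<le> t)"
proof -
  define M :: "('k \<Rightarrow> real) measure" where "M = PiM K (\<lambda>_. exp_measure 1)"
  have M: "finite_measure M"
    unfolding M_def by (intro prob_space.finite_measure prob_space_PiM prob_space_exp_measure) simp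
  have [measurable]: "(\<lambda>x. x k) \<in> borel_measurable M" if "k \<in> K" for k
    unfolding M_def using measurable_component_singleton[OF that, of "\<lambda>_. exp_measure 1"]
    by (simp cong: measurable_cong_sets)
  have one_sided: "holds_except M (2 * exp (- t / (2 * sqrt V))) (\<lambda>x. (\<Sum>k\<in>S. d k * (x k - 1)) \<le> t)"
    if d: "(\<Sum>k\<in>S. (d k)\<^sup>2) \<le> V" for d
  proof -
    \<comment> \<open>With this \<open>h\<close> every \<open>h * d k\<close> is at most 1/2 in
      absolute value, because a single square is at most \<open>V\<close>, and the quadratic term is
      at most 1/2, so that the prefactor \<open>exp (1/2)\<close> is at most 2.\<close>
    define h where "h = 1 / (2 * sqrt V)"
    have hd: "\<bar>h * d k\<bar> \<le> 1 / 2" if "k \<in> S" for k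
    proof -
      have "(d k)\<^sup>2 \<le> V"
        using member_le_sum[of k S "\<lambda>k. (d k)\<^sup>2"] d that K finite_subset[OF K(2,1)] by auto
      then have "\<bar>d k\<bar> \<le> sqrt V" by (simp add: real_le_rsqrt)
      then show ?thesis using V by (simp add: h_def abs_mult field_simps)
    qed
    note tail = exponential_sum_tail[OF K, where c = "\<lambda>k. h * d k" and t = "h * t", folded M_def, OF hd]
    have "2 * (\<Sum>k\<in>S. (h * d k)\<^sup>2) = 2 * h\<^sup>2 * (\<Sum>k\<in>S. (d k)\<^sup>2)"
      by (simp add: power_mult_distrib sum_distrib_left mult.assoc)
    also have "\<dots> \<le> 2 * h\<^sup>2 * V" by (intro mult_left_mono d) simp
    also have "2 * h\<^sup>2 * V = 1/2" using V by (simp add: h_def power2_eq_square)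
    finally have "measure M {x \<in> space M. h * t \<le> (\<Sum>k\<in>S. h * d k * (x k - 1))} \<le> exp (1/2 - h * t)"
      by (intro order_trans[OF tail]) simp_all
    also have "\<dots> = exp (1/2) * exp (- t / (2 * sqrt V))"
      unfolding exp_add[symmetric] by (simp add: h_def)
    also have "\<dots> \<le> 2 * exp (- t / (2 * sqrt V))"
      by (intro mult_right_mono exp_half_le2) simp
    finally have "measure M {x \<in> space M. h * t \<le> (\<Sum>k\<in>S. h * d k * (x k - 1))} \<le> \<dots>" .
    moreover have "{x \<in> space M. h * t \<le> (\<Sum>k\<in>S. h * d k * (x k - 1))} \<in> sets M"
      by measurable (use K in auto)
    moreover have "h > 0" using V by (simp add: h_def)
    ultimately show ?thesis
      unfolding holds_except_def
      by (intro bexI[of _ "{x \<in> space M. h * t \<le> (\<Sum>k\<in>S. h * d k * (x k - 1))}"])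
        (auto simp: mult.assoc simp flip: sum_distrib_left)
  qed
  show ?thesis
    unfolding M_def[symmetric]
    by (rule holds_except_mono[OF holds_except_conj[OF M one_sided[of c] one_sided[of "\<lambda>k. - c k"]]])
      (use V in \<open>auto simp: sum_subtractf sum_negf algebra_simps\<close>)
qed

section \<open>Burke's theorem on the grid\<close>

definition measure_preserving :: "'a measure \<Rightarrow> ('a \<Rightarrow> 'a) \<Rightarrow> bool" where
  "measure_preserving M T \<longleftrightarrow> T \<in> measurable M M \<and> distr M M T = M"

lemma measure_preserving_id: "measure_preserving M (\<lambda>x. x)"
  by (simp add: measure_preserving_def)

lemma measure_preserving_comp:
  assumes "measure_preserving M S" "measure_preserving M T"
  shows "measure_preserving M (\<lambda>x. T (S x))"
  using assms distr_distr[of T M M S M] by (auto simp: measure_preserving_def comp_def)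

text \<open>The involution of Burke's theorem on rate-one coordinates, where \<open>p\<close>, \<open>q\<close> and \<open>p + q\<close> are
  the rates of the coordinates \<open>u\<close>, \<open>v\<close> and \<open>w\<close>.\<close>

definition burke_step :: "real \<Rightarrow> real \<Rightarrow> 'k \<Rightarrow> 'k \<Rightarrow> 'k \<Rightarrow> ('k \<Rightarrow> real) \<Rightarrow> 'k \<Rightarrow> real" where
  "burke_step p q u v w x = x
    (u := p * (x w / (p + q) + max 0 (x u / p - x v / q)),
     v := q * (x w / (p + q) + max 0 (x v / q - x u / p)),
     w := (p + q) * min (x u / p) (x v / q))"

text \<open>By Fubini the three coordinates are integrated with all others held fixed, and there the
  map is the one of \<open>nn_integral_burke\<close>.\<close>

lemma measure_preserving_burke_step:
  assumes "finite K" and uvw: "u \<in> K" "v \<in> K" "w \<in> K" "u \<noteq> v" "u \<noteq> w" "v \<noteq> w"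
    and pq: "p > 0" "q > 0"
  shows "measure_preserving (PiM K (\<lambda>_. exp_measure 1)) (burke_step p q u v w)"
proof -
  define M :: "('a \<Rightarrow> real) measure" where "M = PiM K (\<lambda>_. exp_measure 1)"
  define K' where "K' = K - {u, v, w}"
  define M' :: "('a \<Rightarrow> real) measure" where "M' = PiM K' (\<lambda>_. exp_measure 1)"
  have K: "K = insert w (insert v (insert u K'))" "finite K'" "u \<notin> K'" "v \<notin> insert u K'"
    "w \<notin> insert v (insert u K')"
    using assms by (auto simp: K'_def)
  interpret e: prob_space "exp_measure 1" by (rule prob_space_exp_measure) simp
  interpret P: product_sigma_finite "\<lambda>_::'a. exp_measure 1" ..
  have comp [measurable]: "(\<lambda>x. x k) \<in> borel_measurable M" if "k \<in> K" for k
    unfolding M_def using measurable_component_singleton[OF that, of "\<lambda>_. exp_measure 1"]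
    by (simp cong: measurable_cong_sets)
  have upd: "(\<lambda>x. (f x)(k := h x)) \<in> measurable N M"
    if "f \<in> measurable N M" "h \<in> borel_measurable N" "k \<in> K" for f h k and N :: "'b measure"
    using that unfolding M_def
    by (intro measurable_fun_upd[where J = K]) (auto cong: measurable_cong_sets)
  have meas [measurable]: "burke_step p q u v w \<in> measurable M M"
    unfolding burke_step_def using uvw by (intro upd) (auto intro!: borel_measurable_add)
  have integral_K: "(\<integral>\<^sup>+x. f x \<partial>M) = (\<integral>\<^sup>+x. \<integral>\<^sup>+a. \<integral>\<^sup>+b. \<integral>\<^sup>+c. f (x(u := a, v := b, w := c))
      \<partial>exp_measure 1 \<partial>exp_measure 1 \<partial>exp_measure 1 \<partial>M')" if f: "f \<in> borel_measurable M" for f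
  proof -
    have insert: "(\<integral>\<^sup>+x. g x \<partial>PiM (insert i I) (\<lambda>_. exp_measure 1))
          = (\<integral>\<^sup>+x. \<integral>\<^sup>+y. g (x(i := y)) \<partial>exp_measure 1 \<partial>PiM I (\<lambda>_. exp_measure 1))" (is ?eq)
      and meas: "(\<lambda>x. \<integral>\<^sup>+y. g (x(i := y)) \<partial>exp_measure 1) \<in> borel_measurable (PiM I (\<lambda>_. exp_measure 1))"
      if g: "g \<in> borel_measurable (PiM (insert i I) (\<lambda>_. exp_measure 1))" and "finite I" "i \<notin> I"
      for g :: "('a \<Rightarrow> real) \<Rightarrow> ennreal" and i I
    proof -
      show ?eq by (rule P.product_nn_integral_insert) fact+
      have "(\<lambda>x. g ((\<lambda>(x, y). x(i := y)) x))
          \<in> borel_measurable (PiM I (\<lambda>_. exp_measure 1) \<Otimes>\<^sub>M exp_measure 1)"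
        by (rule measurable_compose[OF measurable_add_dim g])
      then show "(\<lambda>x. \<integral>\<^sup>+y. g (x(i := y)) \<partial>exp_measure 1) \<in> borel_measurable (PiM I (\<lambda>_. exp_measure 1))"
        by (intro e.borel_measurable_nn_integral) (simp add: split_beta')
    qed
    have f': "f \<in> borel_measurable (PiM (insert w (insert v (insert u K'))) (\<lambda>_. exp_measure 1))"
      using f unfolding M_def K(1) .
    note m1 = meas[OF f' _ K(5)]
    note m2 = meas[OF m1 _ K(4)]
    show ?thesis
      unfolding M_def M'_def K(1)
      using insert[OF f' _ K(5)] insert[OF m1 _ K(4)] insert[OF m2 _ K(3)] K(2) by simp
  qed
  have "(\<integral>\<^sup>+x. f (burke_step p q u v w x) \<partial>M) = (\<integral>\<^sup>+x. f x \<partial>M)"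
    if [measurable]: "f \<in> borel_measurable M" for f
  proof -
    have "(\<integral>\<^sup>+x. f (burke_step p q u v w x) \<partial>M) =
        (\<integral>\<^sup>+x. \<integral>\<^sup>+a. \<integral>\<^sup>+b. \<integral>\<^sup>+c. f (burke_step p q u v w (x(u := a, v := b, w := c)))
        \<partial>exp_measure 1 \<partial>exp_measure 1 \<partial>exp_measure 1 \<partial>M')"
      by (rule integral_K) measurable
    also have "\<dots> = (\<integral>\<^sup>+x. \<integral>\<^sup>+a. \<integral>\<^sup>+b. \<integral>\<^sup>+c. f (x(u := a, v := b, w := c))
        \<partial>exp_measure 1 \<partial>exp_measure 1 \<partial>exp_measure 1 \<partial>M')"
    proof (rule nn_integral_cong)
      fix x assume x: "x \<in> space M'"
      define F where "F = (\<lambda>(a, b, c). f (x(u := a, v := b, w := c)))"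
      have "(\<lambda>(a, b, c). x(u := a, v := b, w := c)) \<in> measurable (borel \<Otimes>\<^sub>M borel \<Otimes>\<^sub>M borel) M"
        using x unfolding M_def M'_def K(1) split_beta'
        by (intro measurable_fun_upd[where J = "insert v (insert u K')"]
            measurable_fun_upd[where J = "insert u K'"] measurable_fun_upd[where J = K'] measurable_const)
          (auto cong: measurable_cong_sets)
      then have F: "F \<in> borel_measurable (borel \<Otimes>\<^sub>M borel \<Otimes>\<^sub>M borel)"
        unfolding F_def split_beta' by (rule measurable_compose) fact
      have step: "burke_step p q u v w (x(u := a, v := b, w := c)) =
          x(u := p * (c / (p + q) + max 0 (a / p - b / q)), v := q * (c / (p + q) + max 0 (b / q - a / p)),
            w := (p + q) * min (a / p) (b / q))" for a b c
        using uvw by (auto simp: burke_step_def fun_eq_iff)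
      show "(\<integral>\<^sup>+a. \<integral>\<^sup>+b. \<integral>\<^sup>+c. f (burke_step p q u v w (x(u := a, v := b, w := c)))
          \<partial>exp_measure 1 \<partial>exp_measure 1 \<partial>exp_measure 1)
        = (\<integral>\<^sup>+a. \<integral>\<^sup>+b. \<integral>\<^sup>+c. f (x(u := a, v := b, w := c)) \<partial>exp_measure 1 \<partial>exp_measure 1 \<partial>exp_measure 1)"
        using nn_integral_burke[OF F pq] by (simp add: F_def step)
    qed
    also have "\<dots> = (\<integral>\<^sup>+x. f x \<partial>M)"
      by (rule integral_K[symmetric]) measurable
    finally show ?thesis .
  qed
  then have "distr M M (burke_step p q u v w) = M"
    by (intro measure_eqI) (simp_all add: nn_integral_distr flip: nn_integral_indicator)
  with meas show ?thesis unfolding measure_preserving_def M_def by simp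
qed

text \<open>One rate-one space carries bulk and boundary weights for all rates, so that models with
  different boundary parameters are coupled and can be compared pointwise.\<close>

definition iid :: "nat \<Rightarrow> (nat \<times> nat \<Rightarrow> real) measure" where
  "iid N = PiM ({..N} \<times> {..N}) (\<lambda>_. exp_measure 1)"

lemma prob_space_iid: "prob_space (iid N)"
  unfolding iid_def by (intro prob_space_PiM prob_space_exp_measure) simp

lemma AE_iid_nonneg: "AE x in iid N. \<forall>k\<in>{..N} \<times> {..N}. 0 \<le> x k"
proof -
  have "AE y in exp_measure 1. 0 \<le> y"
    unfolding exp_measure_def by (subst AE_density) (auto simp: exponential_density_def)
  then have "AE x in iid N. 0 \<le> x k" if "k \<in> {..N} \<times> {..N}" for k
    unfolding iid_def using that
    by (intro AE_PiM_component[where P = "\<lambda>y. 0 \<le> y"]) (auto intro: prob_space_exp_measure)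
  then show ?thesis by (intro AE_finite_allI) auto
qed

text \<open>The weights of the stationary model on the columns \<open>C\<close> and rows \<open>R\<close>: column \<open>i\<close> has the
  boundary rate \<open>p i = a i + z\<close>, row \<open>j\<close> the boundary rate \<open>q j = b j - z\<close>, and \<open>(i, j)\<close> the rate
  \<open>a i + b j = p i + q j\<close>.\<close>

definition stat_weight ::
    "(nat \<Rightarrow> real) \<Rightarrow> (nat \<Rightarrow> real) \<Rightarrow> nat set \<Rightarrow> nat set \<Rightarrow> (nat \<times> nat \<Rightarrow> real) \<Rightarrow> nat \<Rightarrow> nat \<Rightarrow> real" where
  "stat_weight p q C R x i j =
    (if i = 0 \<and> j = 0 then 0
     else if j = 0 then if i \<in> C then x (i, 0) / p i else 0
     else if i = 0 then if j \<in> R then x (0, j) / q j else 0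
     else if i \<in> C \<and> j \<in> R then x (i, j) / (p i + q j) else 0)"

text \<open>Sweeps row \<open>j\<close> from left to right. After column \<open>i\<close> the
  coordinate \<open>(0, j)\<close> stores, up to its rate, the vertical increment of the passage
  time at column \<open>i\<close>, and \<open>(i, 0)\<close> the horizontal increment at height
  \<open>j\<close>.\<close>

primrec row_proc ::
    "(nat \<Rightarrow> real) \<Rightarrow> real \<Rightarrow> nat set \<Rightarrow> nat \<Rightarrow> nat \<Rightarrow> (nat \<times> nat \<Rightarrow> real) \<Rightarrow> (nat \<times> nat \<Rightarrow> real)" where
  "row_proc p r C j 0 x = x"
| "row_proc p r C j (Suc i) x = (if Suc i \<in> C
     then burke_step (p (Suc i)) r (Suc i, 0) (0, j) (Suc i, j) (row_proc p r C j i x)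
     else row_proc p r C j i x)"

text \<open>Sweeps the rows upwards; at the end the coordinates \<open>(0, j)\<close> hold, up to
  their rates, the vertical increments along column \<open>N\<close>.\<close>

primrec grid_proc ::
    "(nat \<Rightarrow> real) \<Rightarrow> (nat \<Rightarrow> real) \<Rightarrow> nat set \<Rightarrow> nat set \<Rightarrow> nat \<Rightarrow> nat \<Rightarrow> (nat \<times> nat \<Rightarrow> real) \<Rightarrow> (nat \<times> nat \<Rightarrow> real)" where
  "grid_proc p q C R N 0 x = x"
| "grid_proc p q C R N (Suc j) x = (if Suc j \<in> R
     then row_proc p (q (Suc j)) C (Suc j) N (grid_proc p q C R N j x)
     else grid_proc p q C R N j x)"

lemma measure_preserving_row_proc:
  assumes "1 \<le> j" "j \<le> N" "i \<le> N" "r > 0" "\<And>i. i \<in> C \<Longrightarrow> p i > 0"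
  shows "measure_preserving (iid N) (row_proc p r C j i)"
  using assms(3)
proof (induction i)
  case 0
  have "row_proc p r C j 0 = (\<lambda>x. x)" by (simp add: fun_eq_iff)
  then show ?case by (simp add: measure_preserving_id)
next
  case (Suc i)
  show ?case
  proof (cases "Suc i \<in> C")
    case True
    have "measure_preserving (iid N) (burke_step (p (Suc i)) r (Suc i, 0) (0, j) (Suc i, j))"
      unfolding iid_def using assms Suc.prems True
      by (intro measure_preserving_burke_step) auto
    with Suc True show ?thesis by (simp add: measure_preserving_comp)
  qed (use Suc in simp)
qed

lemma measure_preserving_grid_proc:
  assumes "j \<le> N" "\<And>i. i \<in> C \<Longrightarrow> p i > 0" "\<And>j. j \<in> R \<Longrightarrow> q j > 0"
  shows "measure_preserving (iid N) (grid_proc p q C R N j)"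
  using assms(1)
proof (induction j)
  case 0
  have "grid_proc p q C R N 0 = (\<lambda>x. x)" by (simp add: fun_eq_iff)
  then show ?case by (simp add: measure_preserving_id)
next
  case (Suc j)
  show ?case
  proof (cases "Suc j \<in> R")
    case True
    have "measure_preserving (iid N) (row_proc p (q (Suc j)) C (Suc j) N)"
      using assms Suc.prems True by (intro measure_preserving_row_proc) auto
    with Suc True show ?thesis by (simp add: measure_preserving_comp)
  qed (use Suc in simp)
qed

text \<open>This recursion and \<open>lpp_up_increment\<close> are the first two components of the
  involution, applied to the horizontal increment below, the vertical increment on the left and the
  bulk weight.\<close>

lemma lpp_right_increment:
  "lpp W (Suc i) (Suc j) - lpp W i (Suc j)
    = W (Suc i) (Suc j) + max 0 ((lpp W (Suc i) j - lpp W i j) - (lpp W i (Suc j) - lpp W i j))"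
  by (simp add: lpp.simps(4) max_def)

lemma lpp_up_increment:
  "lpp W (Suc i) (Suc j) - lpp W (Suc i) j
    = W (Suc i) (Suc j) + max 0 ((lpp W i (Suc j) - lpp W i j) - (lpp W (Suc i) j - lpp W i j))"
  by (simp add: lpp.simps(4) max_def)

lemma lpp_skip_column:
  assumes "\<And>i j. 0 \<le> W i j" "\<And>j. W (Suc i) j = 0"
  shows "lpp W (Suc i) j = lpp W i j"
proof (induction j)
  case (Suc j)
  then show ?case
    using lpp_le_up[of W i j] assms by (simp add: lpp.simps(4) max_absorb1)
qed (simp add: assms)

lemma lpp_skip_row:
  assumes "\<And>i j. 0 \<le> W i j" "\<And>i. W i (Suc j) = 0"
  shows "lpp W i (Suc j) = lpp W i j"
proof (induction i)
  case (Suc i)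
  then show ?case
    using lpp_le_right[of W i j] assms by (simp add: lpp.simps(4) max_absorb2)
qed (simp add: assms)

text \<open>Induction along the row: each \<open>burke_step\<close> reads the increments below and
  on the left and writes those above and on the right. The conjuncts on untouched coordinates
  guarantee that the next step still finds its original inputs. Columns outside \<open>C\<close>
  have weight 0 and pass the increments on.\<close>

lemma row_proc_increments:
  fixes p q :: "nat \<Rightarrow> real" and C R :: "nat set" and x :: "nat \<times> nat \<Rightarrow> real"
  defines "W \<equiv> stat_weight p q C R x"
  assumes nonneg: "\<And>i j. 0 \<le> W i j" and pos: "\<And>i. i \<in> C \<Longrightarrow> p i > 0" "q (Suc j) > 0"
    and j: "Suc j \<in> R"
    and y0: "\<And>i. i \<in> C \<Longrightarrow> i > 0 \<Longrightarrow> y (i, 0) / p i = lpp W i j - lpp W (i - 1) j"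
    and y1: "\<And>i. y (i, Suc j) = x (i, Suc j)"
  defines "y' \<equiv> \<lambda>i. row_proc p (q (Suc j)) C (Suc j) i y"
  shows "y' i (0, Suc j) / q (Suc j) = lpp W i (Suc j) - lpp W i j
    \<and> (\<forall>i'\<in>C. 0 < i' \<and> i' \<le> i \<longrightarrow> y' i (i', 0) / p i' = lpp W i' (Suc j) - lpp W (i' - 1) (Suc j))
    \<and> (\<forall>i'>i. y' i (i', 0) = y (i', 0) \<and> y' i (i', Suc j) = y (i', Suc j))
    \<and> (\<forall>i' j'. 0 < j' \<and> j' \<noteq> Suc j \<longrightarrow> y' i (i', j') = y (i', j'))"
proof (induction i)
  case 0
  then show ?case using j by (simp add: y'_def y1 W_def stat_weight_def)
next
  case (Suc i)
  show ?case
  proof (cases "Suc i \<in> C")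
    case True
    have step: "y' (Suc i) = burke_step (p (Suc i)) (q (Suc j)) (Suc i, 0) (0, Suc j) (Suc i, Suc j) (y' i)"
      using True by (simp add: y'_def)
    have w: "y' i (Suc i, Suc j) / (p (Suc i) + q (Suc j)) = W (Suc i) (Suc j)"
      using Suc True j y1 by (simp add: W_def stat_weight_def)
    have u: "y' i (Suc i, 0) / p (Suc i) = lpp W (Suc i) j - lpp W i j"
      using Suc y0[OF True] by simp
    have v: "y' i (0, Suc j) / q (Suc j) = lpp W i (Suc j) - lpp W i j"
      using Suc by simp
    have "y' (Suc i) (0, Suc j) / q (Suc j) = lpp W (Suc i) (Suc j) - lpp W (Suc i) j"
      using pos(2) unfolding lpp_up_increment step burke_step_def u v w by simp
    moreover have "y' (Suc i) (Suc i, 0) / p (Suc i) = lpp W (Suc i) (Suc j) - lpp W i (Suc j)"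
      using pos(1)[OF True] unfolding lpp_right_increment step burke_step_def u v w by simp
    moreover have "y' (Suc i) k = y' i k" if "k \<notin> {(Suc i, 0), (0, Suc j), (Suc i, Suc j)}" for k
      using that by (auto simp: step burke_step_def)
    ultimately show ?thesis using Suc by (auto simp: le_Suc_eq)
  next
    case False
    then have W0: "W (Suc i) j = 0" for j by (simp add: W_def stat_weight_def)
    have "y' (Suc i) = y' i" using False by (simp add: y'_def)
    then show ?thesis using Suc False lpp_skip_column[of W i, OF nonneg W0] by (auto simp: le_Suc_eq)
  qed
qed

text \<open>Induction over the rows: the horizontal increments left by one sweep are the input of
  the next, and the vertical increments at column \<open>N\<close> are final once written.\<close>

lemma grid_proc_increments:
  fixes p q :: "nat \<Rightarrow> real" and C R :: "nat set" and x :: "nat \<times> nat \<Rightarrow> real"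
  defines "W \<equiv> stat_weight p q C R x"
  assumes nonneg: "\<And>i j. 0 \<le> W i j" and pos: "\<And>i. i \<in> C \<Longrightarrow> p i > 0" "\<And>j. j \<in> R \<Longrightarrow> q j > 0"
    and C: "C \<subseteq> {..N}"
  defines "y \<equiv> \<lambda>j. grid_proc p q C R N j x"
  shows "(\<forall>i\<in>C. 0 < i \<longrightarrow> y j (i, 0) / p i = lpp W i j - lpp W (i - 1) j)
    \<and> (\<forall>j'\<in>R. 0 < j' \<and> j' \<le> j \<longrightarrow> y j (0, j') / q j' = lpp W N j' - lpp W N (j' - 1))
    \<and> (\<forall>i j'. j' > j \<longrightarrow> y j (i, j') = x (i, j'))"
proof (induction j)
  case 0
  have "y 0 (i, 0) / p i = lpp W i 0 - lpp W (i - 1) 0" if "i \<in> C" "0 < i" for i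
    using that by (cases i) (auto simp: y_def W_def stat_weight_def)
  then show ?case by (auto simp: y_def)
next
  case (Suc j)
  show ?case
  proof (cases "Suc j \<in> R")
    case True
    have step: "y (Suc j) = row_proc p (q (Suc j)) C (Suc j) N (y j)"
      using True by (simp add: y_def)
    have "y (Suc j) (0, Suc j) / q (Suc j) = lpp W N (Suc j) - lpp W N j
      \<and> (\<forall>i'\<in>C. 0 < i' \<and> i' \<le> N \<longrightarrow> y (Suc j) (i', 0) / p i' = lpp W i' (Suc j) - lpp W (i' - 1) (Suc j))
      \<and> (\<forall>i'>N. y (Suc j) (i', 0) = y j (i', 0) \<and> y (Suc j) (i', Suc j) = y j (i', Suc j))
      \<and> (\<forall>i' j'. 0 < j' \<and> j' \<noteq> Suc j \<longrightarrow> y (Suc j) (i', j') = y j (i', j'))"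
      unfolding step W_def using Suc pos True nonneg
      by (intro row_proc_increments) (auto simp: W_def)
    with Suc C show ?thesis by (auto simp: le_Suc_eq subset_iff)
  next
    case False
    then have W0: "W i (Suc j) = 0" for i by (simp add: W_def stat_weight_def)
    have "y (Suc j) = y j" using False by (simp add: y_def)
    then show ?thesis using Suc False lpp_skip_row[of W j, OF nonneg W0] by (auto simp: le_Suc_eq)
  qed
qed

text \<open>Follow the bottom boundary to \<open>(N, 0)\<close> and then column \<open>N\<close>
  upwards. The horizontal increments are boundary weights and the vertical ones are scaled
  coordinates of a measure-preserving image of \<open>x\<close>, so each of the two sums is a sum of
  independent exponentials.\<close>

theorem lpp_stationary:
  fixes p q :: "nat \<Rightarrow> real" and C R :: "nat set" and x :: "nat \<times> nat \<Rightarrow> real"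
  assumes nonneg: "\<And>i j. 0 \<le> stat_weight p q C R x i j"
    and pos: "\<And>i. i \<in> C \<Longrightarrow> p i > 0" "\<And>j. j \<in> R \<Longrightarrow> q j > 0"
    and CR: "C \<subseteq> {1..N}" "R \<subseteq> {1..N}"
  shows "lpp (stat_weight p q C R x) N N
    = (\<Sum>i\<in>C. x (i, 0) / p i) + (\<Sum>j\<in>R. grid_proc p q C R N N x (0, j) / q j)"
proof -
  define W where "W = stat_weight p q C R x"
  have "lpp W N N = lpp W N 0 + (\<Sum>j<N. lpp W N (Suc j) - lpp W N j)"
    by (subst sum_lessThan_telescope) simp
  also have "lpp W N 0 = (\<Sum>i\<in>{..N}. if i \<in> C then x (i, 0) / p i else 0)"
    unfolding lpp_col using CR by (intro sum.cong) (auto simp: W_def stat_weight_def)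
  also have "\<dots> = (\<Sum>i\<in>C. x (i, 0) / p i)"
    using CR by (simp add: sum.If_cases) (auto intro!: sum.cong)
  also have "(\<Sum>j<N. lpp W N (Suc j) - lpp W N j)
      = (\<Sum>j<N. if Suc j \<in> R then grid_proc p q C R N N x (0, Suc j) / q (Suc j) else 0)"
  proof (intro sum.cong refl)
    fix j assume "j \<in> {..<N}"
    show "lpp W N (Suc j) - lpp W N j
        = (if Suc j \<in> R then grid_proc p q C R N N x (0, Suc j) / q (Suc j) else 0)"
    proof (cases "Suc j \<in> R")
      case True
      have "C \<subseteq> {..N}" using CR by auto
      from conjunct1[OF conjunct2[OF grid_proc_increments[OF nonneg pos this]], rule_format, of "Suc j" N]
      show ?thesis using True \<open>j \<in> _\<close> by (simp add: W_def)
    next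
      case False
      then have "W i (Suc j) = 0" for i by (simp add: W_def stat_weight_def)
      then show ?thesis using False lpp_skip_row[of W j N] nonneg by (simp add: W_def)
    qed
  qed
  also have "\<dots> = (\<Sum>j\<in>Suc ` {..<N}. if j \<in> R then grid_proc p q C R N N x (0, j) / q j else 0)"
    by (simp add: sum.reindex)
  also have "Suc ` {..<N} = {1..N}"
    by (simp add: image_Suc_lessThan)
  also have "(\<Sum>j\<in>{1..N}. if j \<in> R then grid_proc p q C R N N x (0, j) / q j else 0)
      = (\<Sum>j\<in>R. grid_proc p q C R N N x (0, j) / q j)"
    using CR by (simp add: sum.If_cases Int_absorb1)
  finally show ?thesis by (simp add: W_def)
qed

section \<open>Stationary passage times and exit points\<close>

text \<open>The bound \<open>16 * N\<close> leaves room for a sum of squares of at most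
  \<open>4 * N\<close> whose terms \<open>1 / p i\<close> are at most doubled by a shift of the
  parameter.\<close>

lemma col_deviation:
  assumes "C \<subseteq> {..N}" "k \<le> N" "(\<Sum>i\<in>C. (c i)\<^sup>2) \<le> 16 * real N" "N > 0"
  shows "holds_except (iid N) (4 * exp (- t / (8 * sqrt N)))
    (\<lambda>x. \<bar>(\<Sum>i\<in>C. c i * x (i, k)) - (\<Sum>i\<in>C. c i)\<bar> \<le> t)"
proof -
  have inj: "inj_on (\<lambda>i. (i, k)) C" by (auto simp: inj_on_def)
  have "2 * sqrt (16 * real N) = 8 * sqrt N" by (simp add: real_sqrt_mult)
  then show ?thesis
    using exponential_sum_deviation[of "{..N} \<times> {..N}" "(\<lambda>i. (i, k)) ` C" "\<lambda>k. c (fst k)" "16 * real N" t] assms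
    unfolding iid_def by (auto simp: sum.reindex[OF inj])
qed

lemma row_deviation:
  assumes "R \<subseteq> {..N}" "k \<le> N" "(\<Sum>j\<in>R. (c j)\<^sup>2) \<le> 16 * real N" "N > 0"
  shows "holds_except (iid N) (4 * exp (- t / (8 * sqrt N)))
    (\<lambda>x. \<bar>(\<Sum>j\<in>R. c j * x (k, j)) - (\<Sum>j\<in>R. c j)\<bar> \<le> t)"
proof -
  have inj: "inj_on (\<lambda>j. (k, j)) R" by (auto simp: inj_on_def)
  have "2 * sqrt (16 * real N) = 8 * sqrt N" by (simp add: real_sqrt_mult)
  then show ?thesis
    using exponential_sum_deviation[of "{..N} \<times> {..N}" "(\<lambda>j. (k, j)) ` R" "\<lambda>k. c (snd k)" "16 * real N" t] assms
    unfolding iid_def by (auto simp: sum.reindex[OF inj])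
qed

lemma finite_measure_iid: "finite_measure (iid N)"
  by (rule prob_space.finite_measure) (rule prob_space_iid)

lemma stat_weight_nonneg:
  assumes "\<forall>k\<in>{..N} \<times> {..N}. 0 \<le> x k" "C \<subseteq> {1..N}" "R \<subseteq> {1..N}"
    and "\<And>i. i \<in> C \<Longrightarrow> p i > 0" "\<And>j. j \<in> R \<Longrightarrow> q j > 0"
  shows "0 \<le> stat_weight p q C R x i j"
proof -
  have "0 \<le> x (i, j) \<and> 0 \<le> p i + q j" if "i \<in> C" "j \<in> R" for i j
    using that assms add_pos_pos[of "p i" "q j"] by (auto simp: subset_iff intro: less_imp_le)
  moreover have "0 \<le> x (i, 0) \<and> 0 \<le> p i" if "i \<in> C" for i
    using that assms by (auto simp: subset_iff intro: less_imp_le)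
  moreover have "0 \<le> x (0, j) \<and> 0 \<le> q j" if "j \<in> R" for j
    using that assms by (auto simp: subset_iff intro: less_imp_le)
  ultimately show ?thesis by (simp add: stat_weight_def)
qed

text \<open>The first sum is controlled directly and the second through \<open>grid_proc\<close>,
  which preserves the measure; a union bound combines them whatever their dependence.\<close>

lemma stationary_deviation:
  assumes CR: "C \<subseteq> {1..N}" "R \<subseteq> {1..N}" and pos: "\<And>i. i \<in> C \<Longrightarrow> p i > 0" "\<And>j. j \<in> R \<Longrightarrow> q j > 0"
    and sq: "(\<Sum>i\<in>C. (1 / p i)\<^sup>2) \<le> 16 * real N" "(\<Sum>j\<in>R. (1 / q j)\<^sup>2) \<le> 16 * real N" and N: "N > 0"
  shows "holds_except (iid N) (8 * exp (- t / (8 * sqrt N)))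
    (\<lambda>x. \<bar>lpp (stat_weight p q C R x) N N - ((\<Sum>i\<in>C. 1 / p i) + (\<Sum>j\<in>R. 1 / q j))\<bar> \<le> 2 * t)"
proof -
  have CR0: "C \<subseteq> {..N}" "R \<subseteq> {..N}" using CR by auto
  note col = col_deviation[OF CR0(1) le0 sq(1) N, of t]
  have "holds_except (iid N) (4 * exp (- t / (8 * sqrt N)))
    (\<lambda>x. \<bar>(\<Sum>j\<in>R. 1 / q j * grid_proc p q C R N N x (0, j)) - (\<Sum>j\<in>R. 1 / q j)\<bar> \<le> t)"
    using measure_preserving_grid_proc[OF order_refl pos] row_deviation[OF CR0(2) le0 sq(2) N, of t]
    unfolding measure_preserving_def by (intro holds_except_vimage[where T = "grid_proc p q C R N N"]) auto
  note both = holds_except_conj[OF finite_measure_iid col this]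
  show ?thesis
    by (rule holds_except_mono[OF holds_except_conj[OF finite_measure_iid
          holds_except_AE[OF AE_iid_nonneg] both]])
      (auto simp: lpp_stationary[OF stat_weight_nonneg[OF _ CR pos] pos CR])
qed

definition bulk :: "(nat \<Rightarrow> nat \<Rightarrow> real) \<Rightarrow> nat \<Rightarrow> nat \<Rightarrow> real" where
  "bulk W i j = (if i = 0 \<or> j = 0 then 0 else W i j)"

section \<open>Second-order expansions and late exits from the boundary\<close>

lemma inverse_shift_down_le:
  assumes "0 \<le> d" "2 * d \<le> (p :: real)" "p > 0"
  shows "1 / (p - d) \<le> 1 / p + d * (1 / p)\<^sup>2 + 2 * d\<^sup>2 * (1 / p) ^ 3"
proof -
  have "1 / (p - d) = 1 / p + d * (1 / p)\<^sup>2 + d\<^sup>2 * (1 / p)\<^sup>2 * (1 / (p - d))"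
    using assms by (simp add: field_simps power2_eq_square)
  also have "1 / (p - d) \<le> 2 * (1 / p)" using assms by (simp add: field_simps)
  then have "d\<^sup>2 * (1 / p)\<^sup>2 * (1 / (p - d)) \<le> d\<^sup>2 * (1 / p)\<^sup>2 * (2 * (1 / p))"
    by (intro mult_left_mono) auto
  finally show ?thesis by (simp add: power2_eq_square power3_eq_cube ac_simps)
qed

lemma inverse_shift_up_le:
  assumes "0 \<le> d" "(p :: real) > 0"
  shows "1 / (p + d) \<le> 1 / p - d * (1 / p)\<^sup>2 + d\<^sup>2 * (1 / p) ^ 3"
proof -
  have "1 / (p + d) * (p + d) = 1" "1 / p * p = 1" using assms by auto
  then have "1 / (p + d) = 1 / p - d * (1 / p)\<^sup>2 + d\<^sup>2 * (1 / p)\<^sup>2 * (1 / (p + d))"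
    by algebra
  also have "1 / (p + d) \<le> 1 / p" using assms by (simp add: field_simps)
  then have "d\<^sup>2 * (1 / p)\<^sup>2 * (1 / (p + d)) \<le> d\<^sup>2 * (1 / p)\<^sup>2 * (1 / p)"
    by (intro mult_left_mono) auto
  finally show ?thesis by (simp add: power2_eq_square power3_eq_cube ac_simps)
qed

text \<open>With \<open>t = N powr (1/2 + e)\<close>, \<open>d = N powr (-3/10)\<close> and
  \<open>L = N powr (9/10 + e)\<close> the gain \<open>d * L^2 / N\<close> equals
  \<open>N powr (1/2 + 2 * e)\<close>, while the second-order loss is only of order
  \<open>sqrt N\<close>.\<close>

lemma eventually_exit_estimate:
  assumes "e > 0"
  shows "\<forall>\<^sub>F N in sequentially. 2 * real N powr (-3/10) \<le> real N powr (-1/10) \<and>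
    6 * real N powr (1/2 + e) + 4 * real N powr (-3/10) + 16 * (real N powr (-3/10))\<^sup>2 * real N powr (1/10) * real N
      \<le> real N powr (-3/10) * ((real N powr (9/10 + e))\<^sup>2 / real N)"
  using assms by (intro eventually_conj; real_asymp)


text \<open>Stop at the first prefix sum above \<open>L\<close>: its last term overshoots by at most
  \<open>b\<close>. If none exceeds \<open>L\<close>, all of \<open>C\<close> is taken. As 0 is not
  in \<open>C\<close>, the search starts from an empty prefix.\<close>

lemma exists_prefix:
  fixes f :: "nat \<Rightarrow> real"
  assumes "C \<subseteq> {1..N}" and f: "\<And>i. i \<in> C \<Longrightarrow> 0 \<le> f i \<and> f i \<le> b" and "0 \<le> L" "0 \<le> b"
  obtains k where "(\<Sum>i\<in>C \<inter> {..k}. f i) \<le> L + b" "L < (\<Sum>i\<in>C \<inter> {..k}. f i) \<or> C \<subseteq> {..k}"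
proof (cases "L < (\<Sum>i\<in>C. f i)")
  case False
  have "C \<inter> {..N} = C" using assms(1) by auto
  with False that[of N] assms show ?thesis by force
next
  case True
  define P where "P k \<longleftrightarrow> L < (\<Sum>i\<in>C \<inter> {..k}. f i)" for k
  define k where "k = (LEAST k. P k)"
  have CN: "C \<inter> {..N} = C" using assms(1) by auto
  then have "P N" using True by (simp add: P_def)
  then have Pk: "P k" unfolding k_def by (rule LeastI)
  have "C \<inter> {..0} = {}" using assms(1) by auto
  then have "\<not> P 0" using assms by (simp add: P_def)
  then obtain k' where k': "k = Suc k'" using Pk by (cases k) auto
  then have "\<not> P k'" using not_less_Least[of k' P] by (simp add: k_def)
  then have "(\<Sum>i\<in>C \<inter> {..k'}. f i) \<le> L" by (simp add: P_def)
  moreover have "(\<Sum>i\<in>C \<inter> {..k}. f i) \<le> (\<Sum>i\<in>C \<inter> {..k'}. f i) + b"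
  proof (cases "k \<in> C")
    case True
    then have "C \<inter> {..k} = insert k (C \<inter> {..k'})" using k' by (auto simp: le_Suc_eq)
    then show ?thesis using k' f[OF True] by simp
  next
    case False
    then have "C \<inter> {..k} = C \<inter> {..k'}" using k' by (auto simp: le_Suc_eq)
    then show ?thesis using assms by simp
  qed
  ultimately show ?thesis using that[of k] Pk by (force simp: P_def)
qed

text \<open>If a path leaves the row boundary only after collecting mean weight \<open>L\<close>, then by Cauchy--Schwarz
  its boundary columns \<open>A\<close> satisfy \<open>L\<^sup>2 / N \<le> (\<Sum>i\<in>A. (1 / p i)\<^sup>2)\<close>. The shift of \<open>z\<close> by \<open>d\<close>, applied to
  the other columns only, lowers the mean by \<open>d\<close> times this sum, which beats the second-order terms.\<close>

lemma horizontal_exit: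
  fixes p q :: "nat \<Rightarrow> real"
  assumes CR: "C \<subseteq> {1..N}" "R \<subseteq> {1..N}" and N: "N > 0"
    and p: "\<And>i. i \<in> C \<Longrightarrow> real N powr (-1/10) \<le> p i"
    and q: "\<And>j. j \<in> R \<Longrightarrow> real N powr (-1/10) \<le> q j"
    and sq: "(\<Sum>i\<in>C. (1 / p i)\<^sup>2) \<le> 4 * real N" "(\<Sum>j\<in>R. (1 / q j)\<^sup>2) \<le> 4 * real N"
    and balanced: "(\<Sum>i\<in>C. (1 / p i)\<^sup>2) - (\<Sum>j\<in>R. (1 / q j)\<^sup>2) \<le> 4"
    and d: "d = real N powr (-3/10)" "2 * d \<le> real N powr (-1/10)"
    and gain: "6 * t + 4 * d + 16 * d\<^sup>2 * real N powr (1/10) * real N \<le> d * (L\<^sup>2 / real N)" "L \<ge> 0"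
  shows "holds_except (iid N) (12 * exp (- t / (8 * sqrt N)))
    (\<lambda>x. lpp (\<lambda>i j. if i = 0 then 0 else stat_weight p q C R x i j) N N
      \<le> max (lpp (bulk (stat_weight p q C R x)) N N + L + real N powr (1/10) + t)
            ((\<Sum>i\<in>C. 1 / p i) + (\<Sum>j\<in>R. 1 / q j) - 3 * t))"
proof -
  have fin: "finite C" "finite R" using CR finite_subset by blast+
  have d0: "d > 0" using d N by simp
  have pos: "p i > 0" "p i - d > 0" "2 * d \<le> p i" "1 / p i \<le> real N powr (1/10)" if "i \<in> C" for i
  proof -
    show "p i > 0" "2 * d \<le> p i" using p[OF that] d d0 by linarith+
    then show "p i - d > 0" using d0 by linarith
    have "1 / p i \<le> 1 / real N powr (-1/10)"
      using p[OF that] \<open>p i > 0\<close> N by (intro divide_left_mono) auto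
    then show "1 / p i \<le> real N powr (1/10)" by (simp add: powr_minus_divide)
  qed
  have posq: "q j > 0" "q j + d > 0" "1 / q j \<le> real N powr (1/10)" if "j \<in> R" for j
  proof -
    show "q j > 0" using q[OF that] d d0 by linarith
    then show "q j + d > 0" using d0 by linarith
    have "1 / q j \<le> 1 / real N powr (-1/10)"
      using q[OF that] \<open>q j > 0\<close> N by (intro divide_left_mono) auto
    then show "1 / q j \<le> real N powr (1/10)" by (simp add: powr_minus_divide)
  qed
  \<comment> \<open>The columns up to \<open>k\<close> carry a mean boundary weight just above
    \<open>L\<close>, with an overshoot of at most the largest possible \<open>1 / p i\<close>. If
    \<open>L\<close> is not exceeded, no column of \<open>C\<close> remains for a later
    exit.\<close>
  obtain k where k: "(\<Sum>i\<in>C \<inter> {..k}. 1 / p i) \<le> L + real N powr (1/10)"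
      "L < (\<Sum>i\<in>C \<inter> {..k}. 1 / p i) \<or> C \<subseteq> {..k}"
    using exists_prefix[OF CR(1), of "\<lambda>i. 1 / p i" "real N powr (1/10)" L] pos gain(2)
    by (metis less_imp_le powr_ge_zero zero_less_divide_1_iff)
  define A where "A = C \<inter> {..k}"
  define C' where "C' = C - {..k}"
  have A: "A \<union> C' = C" "A \<inter> C' = {}" "finite A" "finite C'"
    using fin by (auto simp: A_def C'_def)
  have split: "(\<Sum>i\<in>C. f i) = (\<Sum>i\<in>A. f i) + (\<Sum>i\<in>C'. f i)" for f :: "nat \<Rightarrow> real"
    using sum.union_disjoint[OF A(3,4,2), of f] A(1) by simp
  have sqA: "(\<Sum>i\<in>A. (1 / p i)\<^sup>2) \<le> 4 * real N"
    using split[of "\<lambda>i. (1 / p i)\<^sup>2"] sq(1) sum_nonneg[of C' "\<lambda>i. (1 / p i)\<^sup>2"] by simp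
  have sqC': "(\<Sum>i\<in>C'. (1 / (p i - d))\<^sup>2) \<le> 16 * real N"
  proof -
    have "(\<Sum>i\<in>C'. (1 / (p i - d))\<^sup>2) \<le> (\<Sum>i\<in>C'. 4 * (1 / p i)\<^sup>2)"
    proof (intro sum_mono)
      fix i assume "i \<in> C'"
      then have i: "i \<in> C" by (simp add: C'_def)
      have "1 / (p i - d) \<le> 2 * (1 / p i)" using pos[OF i] by (simp add: field_simps)
      then have "(1 / (p i - d))\<^sup>2 \<le> (2 * (1 / p i))\<^sup>2" using pos[OF i] by (intro power_mono) auto
      then show "(1 / (p i - d))\<^sup>2 \<le> 4 * (1 / p i)\<^sup>2" by (simp add: power_mult_distrib power_divide)
    qed
    also have "\<dots> \<le> 4 * (\<Sum>i\<in>C. (1 / p i)\<^sup>2)"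
      unfolding split[of "\<lambda>i. (1 / p i)\<^sup>2"] by (simp add: sum_distrib_left sum_nonneg)
    finally show ?thesis using sq(1) by linarith
  qed
  have sqR: "(\<Sum>j\<in>R. (1 / (q j + d))\<^sup>2) \<le> 16 * real N"
  proof -
    have "(\<Sum>j\<in>R. (1 / (q j + d))\<^sup>2) \<le> (\<Sum>j\<in>R. (1 / q j)\<^sup>2)"
      using posq d0 by (intro sum_mono power_mono divide_left_mono) (auto intro!: mult_pos_pos less_imp_le)
    then show ?thesis using sq(2) by linarith
  qed
  define f where "f = (\<Sum>i\<in>C. 1 / p i) + (\<Sum>j\<in>R. 1 / q j)"
  define g where "g = (\<Sum>i\<in>C'. 1 / (p i - d)) + (\<Sum>j\<in>R. 1 / (q j + d))"
  \<comment> \<open>The price of a late exit: the boundary weight of \<open>A\<close> plus the mean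
    of the shifted model on the remaining columns is below the stationary mean by
    \<open>6 * t\<close>, which absorbs all deviations.\<close>
  have late_exit: "(\<Sum>i\<in>A. 1 / p i) + g + 3 * t \<le> f - 3 * t" if "L < (\<Sum>i\<in>A. 1 / p i)"
  proof -
    have cubeC: "(\<Sum>i\<in>C'. (1 / p i) ^ 3) \<le> real N powr (1/10) * (4 * real N)"
    proof -
      have "(\<Sum>i\<in>C'. (1 / p i) ^ 3) \<le> (\<Sum>i\<in>C'. real N powr (1/10) * (1 / p i)\<^sup>2)"
        unfolding power3_eq_cube power2_eq_square mult.assoc using pos by (intro sum_mono mult_right_mono) (auto simp: C'_def)
      also have "\<dots> \<le> real N powr (1/10) * (\<Sum>i\<in>C. (1 / p i)\<^sup>2)"
        unfolding split[of "\<lambda>i. (1 / p i)\<^sup>2"] by (auto simp: sum_distrib_left[symmetric] sum_nonneg intro!: mult_left_mono)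
      also have "\<dots> \<le> real N powr (1/10) * (4 * real N)" by (intro mult_left_mono sq) simp
      finally show ?thesis .
    qed
    have cubeR: "(\<Sum>j\<in>R. (1 / q j) ^ 3) \<le> real N powr (1/10) * (4 * real N)"
    proof -
      have "(\<Sum>i\<in>R. (1 / q i) ^ 3) \<le> (\<Sum>i\<in>R. real N powr (1/10) * (1 / q i)\<^sup>2)"
        unfolding power3_eq_cube power2_eq_square mult.assoc using posq by (intro sum_mono mult_right_mono) auto
      also have "\<dots> \<le> real N powr (1/10) * (4 * real N)"
        unfolding sum_distrib_left[symmetric] by (intro mult_left_mono sq) simp
      finally show ?thesis .
    qed
    have "L\<^sup>2 \<le> (\<Sum>i\<in>A. 1 / p i)\<^sup>2" using that gain(2) by (intro power_mono) auto
    also have "\<dots> \<le> (\<Sum>i\<in>A. (1 / p i)\<^sup>2) * card A"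
      by (rule sum_squared_le_sum_of_squares)
    also have "\<dots> \<le> (\<Sum>i\<in>A. (1 / p i)\<^sup>2) * real N"
    proof (intro mult_left_mono sum_nonneg)
      have "card A \<le> card {1..N}" using CR by (intro card_mono) (auto simp: A_def)
      then show "real (card A) \<le> real N" by simp
    qed simp
    finally have Q: "L\<^sup>2 / real N \<le> (\<Sum>i\<in>A. (1 / p i)\<^sup>2)" using N by (simp add: field_simps)
    have "(\<Sum>i\<in>C'. 1 / (p i - d)) \<le> (\<Sum>i\<in>C'. 1 / p i + d * (1 / p i)\<^sup>2 + 2 * d\<^sup>2 * (1 / p i) ^ 3)"
      using pos d0 by (intro sum_mono inverse_shift_down_le) (auto simp: C'_def)
    moreover have "(\<Sum>j\<in>R. 1 / (q j + d)) \<le> (\<Sum>j\<in>R. 1 / q j - d * (1 / q j)\<^sup>2 + d\<^sup>2 * (1 / q j) ^ 3)"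
      using posq d0 by (intro sum_mono inverse_shift_up_le) auto
    ultimately have "(\<Sum>i\<in>A. 1 / p i) + g \<le> f + d * ((\<Sum>i\<in>C'. (1 / p i)\<^sup>2) - (\<Sum>j\<in>R. (1 / q j)\<^sup>2))
        + 2 * d\<^sup>2 * (\<Sum>i\<in>C'. (1 / p i) ^ 3) + d\<^sup>2 * (\<Sum>j\<in>R. (1 / q j) ^ 3)"
      unfolding f_def g_def split
      by (simp add: sum.distrib sum_subtractf right_diff_distrib flip: sum_distrib_left)
    \<comment> \<open>Both cubic remainders are given the coefficient \<open>2 * d^2\<close>, which
      is generous for the rows; with the bound \<open>4 * N\<close> on the sums of squares they add
      up to the second-order term in \<open>gain\<close>.\<close>
    also have "\<dots> \<le> f + d * (4 - L\<^sup>2 / real N)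
        + 2 * d\<^sup>2 * (real N powr (1/10) * (4 * real N)) + 2 * d\<^sup>2 * (real N powr (1/10) * (4 * real N))"
    proof (intro add_mono mult_left_mono order_refl cubeC)
      show "(\<Sum>i\<in>C'. (1 / p i)\<^sup>2) - (\<Sum>j\<in>R. (1 / q j)\<^sup>2) \<le> 4 - L\<^sup>2 / real N"
        using Q balanced split[of "\<lambda>i. (1 / p i)\<^sup>2"] by linarith
      show "d\<^sup>2 * (\<Sum>j\<in>R. (1 / q j) ^ 3) \<le> 2 * d\<^sup>2 * (real N powr (1/10) * (4 * real N))"
        using cubeR by (intro mult_mono) (auto intro!: sum_nonneg simp: less_imp_le[OF posq(1)])
    qed (use d0 in auto)
    finally show ?thesis using gain by (simp add: algebra_simps)
  qed
  have "A \<subseteq> {..N}" using CR by (auto simp: A_def)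
  from col_deviation[OF this le0, of "\<lambda>i. 1 / p i" t] sqA N
  have ev_A: "holds_except (iid N) (4 * exp (- t / (8 * sqrt N)))
    (\<lambda>x. \<bar>(\<Sum>i\<in>A. 1 / p i * x (i, 0)) - (\<Sum>i\<in>A. 1 / p i)\<bar> \<le> t)" by simp
  have "C' \<subseteq> {1..N}" using CR by (auto simp: C'_def)
  from stationary_deviation[OF this CR(2) _ _ sqC' sqR N, of t] pos posq
  have ev_w: "holds_except (iid N) (8 * exp (- t / (8 * sqrt N)))
    (\<lambda>x. \<bar>lpp (stat_weight (\<lambda>i. p i - d) (\<lambda>j. q j + d) C' R x) N N - g\<bar> \<le> 2 * t)"
    by (auto simp: C'_def g_def)
  note events = holds_except_conj[OF finite_measure_iid holds_except_AE[OF AE_iid_nonneg]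
      holds_except_conj[OF finite_measure_iid ev_A ev_w]]
  show ?thesis
  proof (rule holds_except_mono[OF events], goal_cases)
    case (2 x)
    define W where "W = (\<lambda>i j. if i = 0 then 0 else stat_weight p q C R x i j)"
    have W: "0 \<le> W i j" for i j
      unfolding W_def using stat_weight_nonneg[OF _ CR, of x p q i j] 2 pos(1) posq(1) by simp
    have x0: "0 \<le> x (i, j)" if "i \<le> N" "j \<le> N" for i j using 2 that by simp
    have "lpp W N N \<le> (\<Sum>i\<le>k. W i 0) + max (lpp (\<lambda>i j. if j = 0 then 0 else W i j) N N)
        (lpp (\<lambda>i j. if i \<le> k then 0 else W i j) N N)"
      by (rule lpp_exit_le[OF W]) (simp add: W_def)
    also have "(\<lambda>i j. if j = 0 then 0 else W i j) = bulk (stat_weight p q C R x)"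
      by (auto simp: W_def bulk_def fun_eq_iff)
    also have "(\<Sum>i\<le>k. W i 0) = (\<Sum>i\<in>A. 1 / p i * x (i, 0))"
      unfolding A_def using CR
      by (intro sum.mono_neutral_cong_right) (auto simp: W_def stat_weight_def fin)
    also have "\<dots> \<le> (\<Sum>i\<in>A. 1 / p i) + t" using 2 by linarith
    finally have main: "lpp W N N \<le> (\<Sum>i\<in>A. 1 / p i) + t + max (lpp (bulk (stat_weight p q C R x)) N N)
        (lpp (\<lambda>i j. if i \<le> k then 0 else W i j) N N)" by simp
    have b0: "0 \<le> lpp (bulk (stat_weight p q C R x)) N N"
      using stat_weight_nonneg[OF _ CR, of x p q] 2 pos(1) posq(1)
      by (intro lpp_nonneg) (simp add: bulk_def)
    show ?case
    proof (cases "C \<subseteq> {..k}")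
      case True
      then have "(\<lambda>i j. if i \<le> k then 0 else W i j) = (\<lambda>_ _. 0)"
        by (auto simp: W_def stat_weight_def fun_eq_iff)
      then show ?thesis using main k(1) b0 unfolding W_def A_def by (simp add: lpp_zero)
    next
      case False
      \<comment> \<open>Pointwise coupling: on bulk sites the shifts of \<open>p\<close> and
        \<open>q\<close> cancel, on the bottom boundary the smaller rate \<open>p i - d\<close> only
        enlarges the weights, and on column 0 the left side is 0.\<close>
      have "lpp (\<lambda>i j. if i \<le> k then 0 else W i j) N N
          \<le> lpp (stat_weight (\<lambda>i. p i - d) (\<lambda>j. q j + d) C' R x) N N"
      proof (rule lpp_mono)
        fix i j assume ij: "i \<le> N" "j \<le> N"
        have "x (i, 0) / p i \<le> x (i, 0) / (p i - d)" if "i \<in> C"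
          using pos[OF that] d0 x0[OF ij(1) le0] by (intro divide_left_mono) auto
        moreover have "0 \<le> stat_weight (\<lambda>i. p i - d) (\<lambda>j. q j + d) C' R x i j"
          using 2 pos posq CR by (intro stat_weight_nonneg) (auto simp: C'_def)
        ultimately show "(if i \<le> k then 0 else W i j) \<le> stat_weight (\<lambda>i. p i - d) (\<lambda>j. q j + d) C' R x i j"
          by (auto simp: W_def stat_weight_def C'_def)
      qed
      also have "\<dots> \<le> g + 2 * t" using 2 by linarith
      finally show ?thesis
        using main k late_exit False unfolding W_def[symmetric] f_def[symmetric] A_def[symmetric] by force
    qed
  qed simp
qed


section \<open>Reflection in the diagonal and the balanced lower bound\<close>

lemma measure_preserving_transpose:
  "measure_preserving (iid N) (\<lambda>x. \<lambda>k\<in>{..N} \<times> {..N}. x (prod.swap k))"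
proof -
  have "distr (iid N) (iid N) (\<lambda>x. \<lambda>k\<in>{..N} \<times> {..N}. x (prod.swap k)) = iid N"
    unfolding iid_def
    by (rule distr_PiM_reindex) (auto simp: prob_space_exp_measure)
  moreover have "(\<lambda>x. \<lambda>k\<in>{..N} \<times> {..N}. x (prod.swap k)) \<in> measurable (iid N) (iid N)"
    unfolding iid_def by (intro measurable_restrict measurable_component_singleton) auto
  ultimately show ?thesis by (simp add: measure_preserving_def)
qed

lemma stat_weight_transpose:
  assumes "C \<subseteq> {1..N}" "R \<subseteq> {1..N}"
  shows "stat_weight q p R C (\<lambda>k\<in>{..N} \<times> {..N}. x (prod.swap k)) j i = stat_weight p q C R x i j"
  using assms by (auto simp: stat_weight_def subset_iff add.commute)

lemma lpp_bulk_transpose: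
  assumes "C \<subseteq> {1..N}" "R \<subseteq> {1..N}"
  shows "lpp (bulk (stat_weight q p R C (\<lambda>k\<in>{..N} \<times> {..N}. x (prod.swap k)))) n m
    = lpp (bulk (stat_weight p q C R x)) m n"
proof -
  have "bulk (stat_weight q p R C (\<lambda>k\<in>{..N} \<times> {..N}. x (prod.swap k)))
      = (\<lambda>i j. bulk (stat_weight p q C R x) j i)"
    by (simp only: fun_eq_iff bulk_def stat_weight_transpose[OF assms] disj_commute simp_thms)
  then show ?thesis by (simp only:) (rule lpp_transpose)
qed

text \<open>\<open>horizontal_exit\<close> for the reflected model, carried back by the
  measure-preserving transposition.\<close>

lemma vertical_exit:
  fixes p q :: "nat \<Rightarrow> real"
  assumes CR: "C \<subseteq> {1..N}" "R \<subseteq> {1..N}" and N: "N > 0"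
    and p: "\<And>i. i \<in> C \<Longrightarrow> real N powr (-1/10) \<le> p i"
    and q: "\<And>j. j \<in> R \<Longrightarrow> real N powr (-1/10) \<le> q j"
    and sq: "(\<Sum>i\<in>C. (1 / p i)\<^sup>2) \<le> 4 * real N" "(\<Sum>j\<in>R. (1 / q j)\<^sup>2) \<le> 4 * real N"
    and balanced: "(\<Sum>j\<in>R. (1 / q j)\<^sup>2) - (\<Sum>i\<in>C. (1 / p i)\<^sup>2) \<le> 4"
    and d: "d = real N powr (-3/10)" "2 * d \<le> real N powr (-1/10)"
    and gain: "6 * t + 4 * d + 16 * d\<^sup>2 * real N powr (1/10) * real N \<le> d * (L\<^sup>2 / real N)" "L \<ge> 0"
  shows "holds_except (iid N) (12 * exp (- t / (8 * sqrt N)))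
    (\<lambda>x. lpp (\<lambda>i j. if j = 0 then 0 else stat_weight p q C R x i j) N N
      \<le> max (lpp (bulk (stat_weight p q C R x)) N N + L + real N powr (1/10) + t)
            ((\<Sum>i\<in>C. 1 / p i) + (\<Sum>j\<in>R. 1 / q j) - 3 * t))"
proof -
  let ?T = "\<lambda>x. \<lambda>k\<in>{..N} \<times> {..N}. x (prod.swap k)"
  have bd: "lpp (\<lambda>i j. if i = 0 then 0 else stat_weight q p R C (?T x) i j) N N
      = lpp (\<lambda>i j. if j = 0 then 0 else stat_weight p q C R x i j) N N" for x
    using lpp_transpose[of "\<lambda>i j. if j = 0 then 0 else stat_weight p q C R x i j" N N]
    by (simp only: stat_weight_transpose[OF CR])
  have "holds_except (iid N) (12 * exp (- t / (8 * sqrt N)))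
    (\<lambda>x. lpp (\<lambda>i j. if i = 0 then 0 else stat_weight q p R C x i j) N N
      \<le> max (lpp (bulk (stat_weight q p R C x)) N N + L + real N powr (1/10) + t)
            ((\<Sum>j\<in>R. 1 / q j) + (\<Sum>i\<in>C. 1 / p i) - 3 * t))"
    by (rule horizontal_exit[where d = d]; fact)
  from holds_except_vimage[OF measure_preserving_transpose[unfolded measure_preserving_def, THEN conjunct1]
      measure_preserving_transpose[unfolded measure_preserving_def, THEN conjunct2] this]
  show ?thesis unfolding lpp_bulk_transpose[OF CR] bd by (simp only: add.commute[of "\<Sum>j\<in>R. 1 / q j"])
qed

text \<open>Off the exceptional set the stationary passage time is at least the mean minus
  \<open>2 * t\<close>, and it is the larger of the two passage times with one boundary removed.
  Each of these is at most the mean minus \<open>3 * t\<close>, or at most the bulk plus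
  \<open>L + N powr (1/10) + t\<close>; as \<open>t > 0\<close>, the larger one satisfies the second
  bound. The tail is 8 + 12 + 12.\<close>

theorem balanced_lower_bound:
  fixes p q :: "nat \<Rightarrow> real"
  assumes CR: "C \<subseteq> {1..N}" "R \<subseteq> {1..N}" and N: "N > 0"
    and p: "\<And>i. i \<in> C \<Longrightarrow> real N powr (-1/10) \<le> p i"
    and q: "\<And>j. j \<in> R \<Longrightarrow> real N powr (-1/10) \<le> q j"
    and sq: "(\<Sum>i\<in>C. (1 / p i)\<^sup>2) \<le> 4 * real N" "(\<Sum>j\<in>R. (1 / q j)\<^sup>2) \<le> 4 * real N"
    and balanced: "\<bar>(\<Sum>i\<in>C. (1 / p i)\<^sup>2) - (\<Sum>j\<in>R. (1 / q j)\<^sup>2)\<bar> \<le> 4"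
    and d: "d = real N powr (-3/10)" "2 * d \<le> real N powr (-1/10)"
    and gain: "6 * t + 4 * d + 16 * d\<^sup>2 * real N powr (1/10) * real N \<le> d * (L\<^sup>2 / real N)" "L \<ge> 0"
    and t: "t > 0"
  shows "holds_except (iid N) (32 * exp (- t / (8 * sqrt N)))
    (\<lambda>x. (\<Sum>i\<in>C. 1 / p i) + (\<Sum>j\<in>R. 1 / q j) - 3 * t - L - real N powr (1/10)
      \<le> lpp (bulk (stat_weight p q C R x)) N N)"
proof -
  have pos: "p i > 0" if "i \<in> C" for i using p[OF that] N by (smt (verit) of_nat_0_less_iff powr_gt_zero)
  have posq: "q j > 0" if "j \<in> R" for j using q[OF that] N by (smt (verit) of_nat_0_less_iff powr_gt_zero)
  have stat: "holds_except (iid N) (8 * exp (- t / (8 * sqrt N)))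
      (\<lambda>x. \<bar>lpp (stat_weight p q C R x) N N - ((\<Sum>i\<in>C. 1 / p i) + (\<Sum>j\<in>R. 1 / q j))\<bar> \<le> 2 * t)"
    using sq by (intro stationary_deviation CR pos posq N) auto
  have diffs: "(\<Sum>i\<in>C. (1 / p i)\<^sup>2) - (\<Sum>j\<in>R. (1 / q j)\<^sup>2) \<le> 4"
      "(\<Sum>j\<in>R. (1 / q j)\<^sup>2) - (\<Sum>i\<in>C. (1 / p i)\<^sup>2) \<le> 4"
    using balanced by linarith+
  have exits: "holds_except (iid N) (12 * exp (- t / (8 * sqrt N)))
    (\<lambda>x. lpp (\<lambda>i j. if i = 0 then 0 else stat_weight p q C R x i j) N N
      \<le> max (lpp (bulk (stat_weight p q C R x)) N N + L + real N powr (1/10) + t)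
            ((\<Sum>i\<in>C. 1 / p i) + (\<Sum>j\<in>R. 1 / q j) - 3 * t))"
    "holds_except (iid N) (12 * exp (- t / (8 * sqrt N)))
    (\<lambda>x. lpp (\<lambda>i j. if j = 0 then 0 else stat_weight p q C R x i j) N N
      \<le> max (lpp (bulk (stat_weight p q C R x)) N N + L + real N powr (1/10) + t)
            ((\<Sum>i\<in>C. 1 / p i) + (\<Sum>j\<in>R. 1 / q j) - 3 * t))"
    by (rule horizontal_exit[where d = d]; fact) (rule vertical_exit[where d = d]; fact)
  note events = holds_except_conj[OF finite_measure_iid holds_except_AE[OF AE_iid_nonneg]
      holds_except_conj[OF finite_measure_iid stat holds_except_conj[OF finite_measure_iid exits]]]
  show ?thesis
  proof (rule holds_except_mono[OF events], goal_cases)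
    case (2 x)
    have W: "0 \<le> stat_weight p q C R x i j" for i j
      using stat_weight_nonneg[OF _ CR pos posq] 2 by simp
    have W0: "stat_weight p q C R x 0 0 = 0" by (simp add: stat_weight_def)
    from 2 show ?case
      using lpp_split_boundary[of "stat_weight p q C R x" N N, OF W W0] t by linarith
  qed simp
qed

section \<open>Bounds for a rectangle\<close>

text \<open>The parameter \<open>z\<close> cancels in \<open>p i + q j\<close>, so a single bulk
  model sits inside the stationary models for all \<open>z\<close>.\<close>

lemma bulk_cong:
  assumes "\<And>i j. i \<in> C \<Longrightarrow> j \<in> R \<Longrightarrow> p i + q j = p' i + q' j"
  shows "bulk (stat_weight p q C R x) = bulk (stat_weight p' q' C R x)"
  using assms by (auto simp: bulk_def stat_weight_def fun_eq_iff)

section \<open>Convexity and the minimising parameter\<close>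

definition stat_mean :: "(nat \<Rightarrow> real) \<Rightarrow> (nat \<Rightarrow> real) \<Rightarrow> nat \<Rightarrow> nat \<Rightarrow> real \<Rightarrow> real" where
  "stat_mean a b m n z = (\<Sum>i=1..m. 1 / (a i + z)) + (\<Sum>j=1..n. 1 / (b j - z))"

lemma inverse_tangent:
  assumes "(x :: real) > 0" "y > 0"
  shows "1 / x - (y - x) * (1 / x)\<^sup>2 \<le> 1 / y"
proof -
  have "1 / y - (1 / x - (y - x) * (1 / x)\<^sup>2) = (y - x)\<^sup>2 / (y * x\<^sup>2)"
    using assms by (simp add: field_simps power2_eq_square)
  also have "\<dots> \<ge> 0" using assms by simp
  finally show ?thesis by simp
qed

text \<open>Sum the tangent lines at \<open>z\<close>, which lie below the convex function
  \<open>1 / x\<close>: at a critical point their slopes cancel.\<close>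

lemma stat_mean_minimal:
  assumes pos: "\<And>i. i \<in> {1..m} \<Longrightarrow> 0 < a i + z \<and> 0 < a i + w"
      "\<And>j. j \<in> {1..n} \<Longrightarrow> 0 < b j - z \<and> 0 < b j - w"
    and crit: "(\<Sum>i=1..m. (1 / (a i + z))\<^sup>2) = (\<Sum>j=1..n. (1 / (b j - z))\<^sup>2)"
  shows "stat_mean a b m n z \<le> stat_mean a b m n w"
proof -
  have "(\<Sum>i=1..m. 1 / (a i + z) - (w - z) * (1 / (a i + z))\<^sup>2) \<le> (\<Sum>i=1..m. 1 / (a i + w))"
    using pos(1) inverse_tangent[of "a i + z" "a i + w" for i] by (intro sum_mono) auto
  moreover have "(\<Sum>j=1..n. 1 / (b j - z) - (z - w) * (1 / (b j - z))\<^sup>2) \<le> (\<Sum>j=1..n. 1 / (b j - w))"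
    using pos(2) inverse_tangent[of "b j - z" "b j - w" for j] by (intro sum_mono) auto
  ultimately show ?thesis
    unfolding sum_subtractf sum_distrib_left[symmetric] crit stat_mean_def left_diff_distrib
    by linarith
qed

text \<open>Shifting \<open>z\<close> and scaling the weights reduces to \<open>min a = 0\<close> and \<open>min b = 1\<close>, so that \<open>I = (0, 1)\<close>.\<close>

locale normalized =
  fixes a b :: "nat \<Rightarrow> real" and m n :: nat
  assumes mn: "m \<ge> 1" "n \<ge> 1"
    and a: "\<And>i. i \<in> {1..m} \<Longrightarrow> 0 \<le> a i" and b: "\<And>j. j \<in> {1..n} \<Longrightarrow> 1 \<le> b j"
begin

abbreviation N where "N \<equiv> m + n"

lemma CR: "{1..m} \<subseteq> {1..N}" "{1..n} \<subseteq> {1..N}" and N: "N > 0"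
  using mn by auto

lemma pos: "i \<in> {1..m} \<Longrightarrow> 0 < z \<Longrightarrow> a i + z > 0" "j \<in> {1..n} \<Longrightarrow> z < 1 \<Longrightarrow> b j - z > 0"
  using a[of i] b[of j] by auto

abbreviation Sa where "Sa z \<equiv> \<Sum>i=1..m. (1 / (a i + z))\<^sup>2"
abbreviation Sb where "Sb z \<equiv> \<Sum>j=1..n. (1 / (b j - z))\<^sup>2"

lemma Sa_le: "1/2 \<le> z \<Longrightarrow> Sa z \<le> 4 * N"
proof -
  assume z: "1/2 \<le> z"
  have "Sa z \<le> (\<Sum>i=1..m. 2\<^sup>2)"
    using a z by (intro sum_mono power_mono) (force simp: divide_simps)+
  then show ?thesis by simp
qed

lemma Sb_le: "z \<le> 1/2 \<Longrightarrow> Sb z \<le> 4 * N"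
proof -
  assume z: "z \<le> 1/2"
  have "Sb z \<le> (\<Sum>j=1..n. 2\<^sup>2)"
    using b z by (intro sum_mono power_mono) (force simp: divide_simps)+
  then show ?thesis by simp
qed

text \<open>Intermediate value theorem for \<open>Sb - Sa\<close>. Whichever half of the interval
  contains \<open>z\<close>, one of the two sums is bounded there by \<open>Sa_le\<close> or
  \<open>Sb_le\<close>, and the equality bounds the other.\<close>

lemma crossing:
  assumes "0 < l" "l \<le> u" "u < 1" "Sb l \<le> Sa l" "Sa u \<le> Sb u"
  obtains z where "l \<le> z" "z \<le> u" "Sa z = Sb z" "Sa z \<le> 4 * N" "Sb z \<le> 4 * N"
proof -
  have "continuous_on {l..u} (\<lambda>z. Sb z - Sa z)"
    using pos assms by (intro continuous_intros) (force dest: pos)+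
  then obtain z where "l \<le> z" "z \<le> u" "Sb z - Sa z = 0"
    using IVT'[of "\<lambda>z. Sb z - Sa z" l 0 u] assms by auto
  then show ?thesis using that[of z] Sa_le[of z] Sb_le[of z] by linarith
qed

lemma critical_point:
  assumes "i0 \<in> {1..m}" "a i0 = 0" "j0 \<in> {1..n}" "b j0 = 1"
  obtains z where "0 < z" "z < 1" "Sa z = Sb z" "Sa z \<le> 4 * N" "Sb z \<le> 4 * N"
proof -
  \<comment> \<open>So close to 0 the term of \<open>i0\<close> alone equals \<open>4 * N\<close>,
    which is the general bound for \<open>Sb l\<close>; at \<open>1 - l\<close> the term of
    \<open>j0\<close> does the same against \<open>Sa\<close>.\<close>
  define l where "l = 1 / (2 * sqrt N)"
  have sN: "sqrt N > 1" using mn by simp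
  then have l: "0 < l" "l \<le> 1/2" by (auto simp: l_def field_simps)
  have l2: "(1 / l)\<^sup>2 = 4 * real N" by (simp add: l_def power_mult_distrib)
  have "Sb l \<le> (1 / l)\<^sup>2" using Sb_le[OF l(2)] l2 by simp
  also have "(1 / l)\<^sup>2 \<le> Sa l"
    using member_le_sum[of i0 "{1..m}" "\<lambda>i. (1 / (a i + l))\<^sup>2"] assms by simp
  finally have 1: "Sb l \<le> Sa l" .
  have "Sa (1 - l) \<le> (1 / l)\<^sup>2" using Sa_le[of "1 - l"] l l2 by simp
  also have "(1 / l)\<^sup>2 \<le> Sb (1 - l)"
    using member_le_sum[of j0 "{1..n}" "\<lambda>j. (1 / (b j - (1 - l)))\<^sup>2"] assms by simp
  finally have 2: "Sa (1 - l) \<le> Sb (1 - l)" .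
  obtain z where "l \<le> z" "z \<le> 1 - l" "Sa z = Sb z" "Sa z \<le> 4 * N" "Sb z \<le> 4 * N"
    by (rule crossing[OF l(1) _ _ 1 2]) (use l in linarith)+
  then show ?thesis using that[of z] l by linarith
qed

text \<open>Nonnegative boundary weights can only increase the passage time, so the bulk is
  dominated by the stationary model at the critical point \<open>z\<close>.\<close>

lemma upper_bound:
  assumes "i0 \<in> {1..m}" "a i0 = 0" "j0 \<in> {1..n}" "b j0 = 1"
  obtains z where "0 < z" "z < 1" "\<And>w. 0 < w \<Longrightarrow> w < 1 \<Longrightarrow> stat_mean a b m n z \<le> stat_mean a b m n w"
    "holds_except (iid N) (8 * exp (- t / (8 * sqrt N)))
      (\<lambda>x. lpp (bulk (stat_weight a b {1..m} {1..n} x)) N N \<le> stat_mean a b m n z + 2 * t)"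
proof -
  obtain z where z: "0 < z" "z < 1" "Sa z = Sb z" "Sa z \<le> 4 * N" "Sb z \<le> 4 * N"
    using critical_point[OF assms] .
  let ?W = "stat_weight (\<lambda>i. a i + z) (\<lambda>j. b j - z) {1..m} {1..n}"
  have "bulk (stat_weight a b {1..m} {1..n} x) = bulk (?W x)" for x
    by (rule bulk_cong) simp
  moreover have "holds_except (iid N) (8 * exp (- t / (8 * sqrt N)))
    (\<lambda>x. \<bar>lpp (?W x) N N - stat_mean a b m n z\<bar> \<le> 2 * t)"
    unfolding stat_mean_def using z pos by (intro stationary_deviation CR N) auto
  note ev = holds_except_conj[OF finite_measure_iid holds_except_AE[OF AE_iid_nonneg] this]
  have "holds_except (iid N) (8 * exp (- t / (8 * sqrt N))) (\<lambda>x. lpp (bulk (?W x)) N N \<le> stat_mean a b m n z + 2 * t)"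
  proof (rule holds_except_mono[OF ev], goal_cases)
    case (2 x)
    have "0 \<le> ?W x i j" for i j
      using 2 z pos by (intro stat_weight_nonneg[OF _ CR]) auto
    then have "lpp (bulk (?W x)) N N \<le> lpp (?W x) N N"
      by (intro lpp_mono) (simp add: bulk_def)
    then show ?case using 2 by linarith
  qed simp
  ultimately show ?thesis
    using that[of z] z stat_mean_minimal[of m a z _ n b] pos by (auto simp del: atLeastAtMost_iff)
qed

end

section \<open>Lower bounds inside the interval and near its ends\<close>

lemma lpp_ge_column:
  assumes nonneg: "\<And>i j. 0 \<le> W i j" and "i \<le> m"
  shows "(\<Sum>j\<le>n. W i j) \<le> lpp W m n"
proof -
  have "lpp W i n \<le> lpp W m n"
    by (rule lift_Suc_mono_le[of "\<lambda>i. lpp W i n", OF lpp_le_right[OF nonneg] \<open>i \<le> m\<close>])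
  moreover have "(\<Sum>j\<le>n. W i j) \<le> lpp W i n"
  proof (induction n)
    case 0
    have "(\<Sum>i'\<in>{i}. W i' 0) \<le> (\<Sum>i'\<le>i. W i' 0)" by (intro sum_mono2) (auto simp: nonneg)
    then show ?case by (simp add: lpp_col)
  next
    case (Suc n)
    have "W i (Suc n) + lpp W i n \<le> lpp W i (Suc n)"
      by (cases i) (auto simp: lpp.simps(4))
    with Suc show ?case by simp
  qed
  ultimately show ?thesis by linarith
qed

text \<open>Discrete intermediate value argument: step back once from the first index above
  \<open>T\<close>; one step raises \<open>s\<close> by at most \<open>c\<close>.\<close>

lemma exists_balanced_index:
  fixes s :: "nat \<Rightarrow> real"
  assumes "s 0 \<le> T" "\<And>k. k < n \<Longrightarrow> s (Suc k) \<le> s k + c" "T < s n"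
  obtains k where "k < n" "s k \<le> T" "T \<le> s k + c"
proof -
  define k where "k = (LEAST k. T < s k)"
  have k: "T < s k" unfolding k_def by (rule LeastI) fact
  then obtain k' where k': "k = Suc k'" using assms(1) by (cases k) auto
  then have "s k' \<le> T" using not_less_Least[of k' "\<lambda>k. T < s k"] by (simp add: k_def)
  moreover have "k \<le> n" unfolding k_def by (rule Least_le) fact
  ultimately show ?thesis using that[of k'] k k' assms(2)[of k'] by force
qed

context normalized
begin

text \<open>A crossing between \<open>eps\<close> and \<open>1 - eps\<close> keeps all boundary
  rates at least \<open>eps\<close>, so \<open>balanced_lower_bound\<close> applies to the whole
  rectangle.\<close>

lemma interior_lower_bound:
  assumes eps: "eps = real N powr (-1/10)" "eps \<le> 1/2"
    and cross: "Sb eps \<le> Sa eps" "Sa (1 - eps) \<le> Sb (1 - eps)"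
    and d: "d = real N powr (-3/10)" "2 * d \<le> eps"
    and gain: "6 * t + 4 * d + 16 * d\<^sup>2 * real N powr (1/10) * real N \<le> d * (L\<^sup>2 / real N)" "L \<ge> 0"
    and t: "t > 0"
  obtains z where "0 < z" "z < 1" "holds_except (iid N) (32 * exp (- t / (8 * sqrt N)))
    (\<lambda>x. stat_mean a b m n z - 3 * t - L - real N powr (1/10)
      \<le> lpp (bulk (stat_weight a b {1..m} {1..n} x)) N N)"
proof -
  have eps0: "eps > 0" using mn unfolding eps(1) powr_gt_zero by linarith
  obtain z where z: "eps \<le> z" "z \<le> 1 - eps" "Sa z = Sb z" "Sa z \<le> 4 * N" "Sb z \<le> 4 * N"
    by (rule crossing[OF eps0 _ _ cross]) (use eps eps0 in linarith)+
  let ?W = "stat_weight (\<lambda>i. a i + z) (\<lambda>j. b j - z) {1..m} {1..n}"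
  have bulk: "bulk (stat_weight a b {1..m} {1..n} x) = bulk (?W x)" for x
    by (rule bulk_cong) simp
  have "holds_except (iid N) (32 * exp (- t / (8 * sqrt N)))
    (\<lambda>x. stat_mean a b m n z - 3 * t - L - real N powr (1/10) \<le> lpp (bulk (?W x)) N N)"
    unfolding stat_mean_def
  proof (rule balanced_lower_bound[where d = d])
    show "real N powr (-1/10) \<le> a i + z" if "i \<in> {1..m}" for i
      using a[OF that] z eps by linarith
    show "real N powr (-1/10) \<le> b j - z" if "j \<in> {1..n}" for j
      using b[OF that] z eps by linarith
  qed (use CR N z d eps gain t in auto)
  then show ?thesis using that[of z] z eps0 unfolding bulk by simp
qed

text \<open>Three pieces are concatenated: two balanced blocks, each costing
  \<open>3 * t + L + N powr (1/10)\<close>, and the straight run in column \<open>i0\<close>,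
  costing \<open>t\<close>. The mean further loses \<open>1 / eps = N powr (1/10)\<close> for the
  boundary term of column \<open>i0\<close> and at most \<open>2 * eps\<close> for each row of the
  run. The tail is 32 + 32 + 4.\<close>

lemma edge_lower_bound:
  assumes i0: "i0 \<in> {1..m}" "a i0 = 0"
    and eps: "eps = real N powr (-1/10)" "eps \<le> 1/2"
    and edge: "Sa eps \<le> Sb eps"
    and d: "d = real N powr (-3/10)" "2 * d \<le> eps"
    and gain: "6 * t + 4 * d + 16 * d\<^sup>2 * real N powr (1/10) * real N \<le> d * (L\<^sup>2 / real N)" "L \<ge> 0"
    and t: "t > 0"
  shows "holds_except (iid N) (68 * exp (- t / (8 * sqrt N)))
    (\<lambda>x. stat_mean a b m n eps - 7 * t - 2 * L - 3 * real N powr (1/10) - 2 * eps * real N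
      \<le> lpp (bulk (stat_weight a b {1..m} {1..n} x)) N N)"
proof -
  have eps0: "eps > 0" using mn unfolding eps(1) powr_gt_zero by linarith
  define p where "p i = a i + eps" for i
  define q where "q j = b j - eps" for j
  have p: "eps \<le> p i" if "i \<in> {1..m}" for i using a[OF that] by (simp add: p_def)
  have q: "1/2 \<le> q j" if "j \<in> {1..n}" for j using b[OF that] eps by (simp add: q_def)
  define C1 where "C1 = {1..<i0}"
  define C2 where "C2 = {i0<..m}"
  have C: "{1..m} = insert i0 (C1 \<union> C2)" "i0 \<notin> C1 \<union> C2" "C1 \<inter> C2 = {}" "finite C1" "finite C2"
    using i0 by (auto simp: C1_def C2_def)
  have splitC: "(\<Sum>i=1..m. f i) = f i0 + (\<Sum>i\<in>C1. f i) + (\<Sum>i\<in>C2. f i)" for f :: "nat \<Rightarrow> real"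
    unfolding C(1) using C by (simp add: sum.union_disjoint)
  have Sb4: "(\<Sum>j=1..n. (1 / q j)\<^sup>2) \<le> 4 * N" using Sb_le eps by (simp add: q_def)
  \<comment> \<open>The term of column \<open>i0\<close> makes the columns on its two sides together
    strictly lighter than all the rows.\<close>
  have SaSb: "(1 / eps)\<^sup>2 + (\<Sum>i\<in>C1. (1 / p i)\<^sup>2) + (\<Sum>i\<in>C2. (1 / p i)\<^sup>2) \<le> (\<Sum>j=1..n. (1 / q j)\<^sup>2)"
    using edge splitC[of "\<lambda>i. (1 / p i)\<^sup>2"] i0 by (simp add: p_def q_def)
  have S0: "0 \<le> (\<Sum>i\<in>C1. (1 / p i)\<^sup>2)" "0 \<le> (\<Sum>i\<in>C2. (1 / p i)\<^sup>2)" "0 < (1 / eps)\<^sup>2"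
    using eps0 by (auto intro!: sum_nonneg)
  have lt: "(\<Sum>i\<in>C1. (1 / p i)\<^sup>2) < (\<Sum>j=1..n. (1 / q j)\<^sup>2)"
      "(\<Sum>i\<in>C2. (1 / p i)\<^sup>2) < (\<Sum>j=1..n. (1 / q j)\<^sup>2)"
    using S0 SaSb by linarith+
  then have sqC: "(\<Sum>i\<in>C1. (1 / p i)\<^sup>2) \<le> 4 * N" "(\<Sum>i\<in>C2. (1 / p i)\<^sup>2) \<le> 4 * N"
    using Sb4 by linarith+
  have q4: "(1 / q j)\<^sup>2 \<le> 4" if "j \<in> {1..n}" for j
  proof -
    have "1 / q j \<le> 2" using q[OF that] by (simp add: field_simps)
    then have "(1 / q j)\<^sup>2 \<le> 2\<^sup>2" using q[OF that] by (intro power_mono) auto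
    then show ?thesis by simp
  qed
  \<comment> \<open>Rows are added from the bottom until they balance the columns left of
    \<open>i0\<close>. A single row contributes at most 4, which is the tolerance of
    \<open>balanced_lower_bound\<close>.\<close>
  obtain l1 where l1: "l1 < n" "(\<Sum>j=1..l1. (1 / q j)\<^sup>2) \<le> (\<Sum>i\<in>C1. (1 / p i)\<^sup>2)"
      "(\<Sum>i\<in>C1. (1 / p i)\<^sup>2) \<le> (\<Sum>j=1..l1. (1 / q j)\<^sup>2) + 4"
    by (rule exists_balanced_index[of "\<lambda>k. \<Sum>j=1..k. (1 / q j)\<^sup>2" "\<Sum>i\<in>C1. (1 / p i)\<^sup>2" n 4])
      (use S0 lt q4 in auto)
  \<comment> \<open>The same from the top row downwards for the columns right of
    \<open>i0\<close>.\<close>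
  obtain k2 where k2: "k2 < n" "(\<Sum>j\<in>{n-k2<..n}. (1 / q j)\<^sup>2) \<le> (\<Sum>i\<in>C2. (1 / p i)\<^sup>2)"
      "(\<Sum>i\<in>C2. (1 / p i)\<^sup>2) \<le> (\<Sum>j\<in>{n-k2<..n}. (1 / q j)\<^sup>2) + 4"
  proof (rule exists_balanced_index[of "\<lambda>k. \<Sum>j\<in>{n-k<..n}. (1 / q j)\<^sup>2" "\<Sum>i\<in>C2. (1 / p i)\<^sup>2" n 4])
    fix k assume "k < n"
    then have "{n - Suc k<..n} = insert (n - k) {n - k<..n}" by auto
    then show "(\<Sum>j\<in>{n - Suc k<..n}. (1 / q j)\<^sup>2) \<le> (\<Sum>j\<in>{n-k<..n}. (1 / q j)\<^sup>2) + 4"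
      using q4[of "n - k"] \<open>k < n\<close> by simp
  next
    have "{0<..n} = {1..n}" by auto
    then show "(\<Sum>i\<in>C2. (1 / p i)\<^sup>2) < (\<Sum>j\<in>{n - n<..n}. (1 / q j)\<^sup>2)" using lt by simp
  qed (use S0 in auto)
  define l2 where "l2 = n - k2"
  define R1 where "R1 = {1..l1}"
  define R2 where "R2 = {l2<..n}"
  define Rm where "Rm = {l1<..l2}"
  have sub: "R1 \<subseteq> {1..n}" "R2 \<subseteq> {1..n}" "C1 \<subseteq> {1..m}" "C2 \<subseteq> {1..m}" "Rm \<subseteq> {1..n}"
    using l1(1) i0 by (auto simp: R1_def R2_def C1_def C2_def Rm_def l2_def)
  \<comment> \<open>Overlapping blocks would cover all rows, although together they weigh at most as
    much as the columns beside \<open>i0\<close>, which is strictly less than all the rows.\<close>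
  have "l1 \<le> l2"
  proof (rule ccontr)
    assume "\<not> l1 \<le> l2"
    then have "(\<Sum>j=1..n. (1 / q j)\<^sup>2) \<le> (\<Sum>j\<in>R1 \<union> R2. (1 / q j)\<^sup>2)"
      by (intro sum_mono2) (auto simp: R1_def R2_def)
    also have "\<dots> \<le> (\<Sum>j\<in>R1. (1 / q j)\<^sup>2) + (\<Sum>j\<in>R2. (1 / q j)\<^sup>2)"
      by (simp add: sum_Un R1_def R2_def sum_nonneg)
    also have "\<dots> \<le> (\<Sum>i\<in>C1. (1 / p i)\<^sup>2) + (\<Sum>i\<in>C2. (1 / p i)\<^sup>2)"
      unfolding R1_def R2_def l2_def by (intro add_mono l1 k2)
    finally show False using SaSb S0 by linarith
  qed
  then have R: "{1..n} = R1 \<union> Rm \<union> R2" "R1 \<inter> Rm = {}" "(R1 \<union> Rm) \<inter> R2 = {}"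
      "finite R1" "finite R2" "finite Rm"
    using l1(1) by (auto simp: R1_def R2_def Rm_def l2_def)
  have splitR: "(\<Sum>j=1..n. f j) = (\<Sum>j\<in>R1. f j) + (\<Sum>j\<in>Rm. f j) + (\<Sum>j\<in>R2. f j)" for f :: "nat \<Rightarrow> real"
    unfolding R(1) using R by (simp add: sum.union_disjoint)
  have sqR: "(\<Sum>j\<in>R'. (1 / q j)\<^sup>2) \<le> 4 * N" if "R' \<subseteq> {1..n}" for R'
    using sum_mono2[of "{1..n}" R' "\<lambda>j. (1 / q j)\<^sup>2"] that Sb4 by simp
  have lower: "holds_except (iid N) (32 * exp (- t / (8 * sqrt N)))
      (\<lambda>x. (\<Sum>i\<in>C'. 1 / p i) + (\<Sum>j\<in>R'. 1 / q j) - 3 * t - L - real N powr (1/10)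
        \<le> lpp (bulk (stat_weight p q C' R' x)) N N)"
    if "C' \<subseteq> {1..m}" "R' \<subseteq> {1..n}" and le: "(\<Sum>i\<in>C'. (1 / p i)\<^sup>2) \<le> 4 * N"
      and bal: "(\<Sum>j\<in>R'. (1 / q j)\<^sup>2) \<le> (\<Sum>i\<in>C'. (1 / p i)\<^sup>2)"
        "(\<Sum>i\<in>C'. (1 / p i)\<^sup>2) \<le> (\<Sum>j\<in>R'. (1 / q j)\<^sup>2) + 4" for C' R'
  proof (rule balanced_lower_bound[where d = d])
    show "real N powr (-1/10) \<le> p i" if "i \<in> C'" for i
      using p[of i] that \<open>C' \<subseteq> _\<close> eps by auto
    show "real N powr (-1/10) \<le> q j" if "j \<in> R'" for j
      using q[of j] that \<open>R' \<subseteq> _\<close> eps by force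
  qed (use that CR N d eps gain t sqR[of R'] in \<open>auto simp: abs_le_iff\<close>)
  have ev1: "holds_except (iid N) (32 * exp (- t / (8 * sqrt N)))
      (\<lambda>x. (\<Sum>i\<in>C1. 1 / p i) + (\<Sum>j\<in>R1. 1 / q j) - 3 * t - L - real N powr (1/10)
        \<le> lpp (bulk (stat_weight p q C1 R1 x)) N N)"
    using l1 sqC sub by (intro lower) (auto simp: R1_def)
  have ev2: "holds_except (iid N) (32 * exp (- t / (8 * sqrt N)))
      (\<lambda>x. (\<Sum>i\<in>C2. 1 / p i) + (\<Sum>j\<in>R2. 1 / q j) - 3 * t - L - real N powr (1/10)
        \<le> lpp (bulk (stat_weight p q C2 R2 x)) N N)"
    using k2 sqC sub by (intro lower) (auto simp: R2_def l2_def)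
  \<comment> \<open>In column \<open>i0\<close> the bulk rate is \<open>a i0 + b j = b j\<close>, so
    the run has means \<open>1 / b j\<close> in place of \<open>1 / q j\<close>, and
    \<open>b j\<close> exceeds \<open>q j\<close> only by \<open>eps\<close>.\<close>
  have inv_b: "1 / b j \<le> 1 / q j" "1 / q j - 2 * eps \<le> 1 / b j" if "j \<in> {1..n}" for j
  proof -
    have "1 / q j - 1 / b j = eps * (1 / q j * (1 / b j))"
      using q[OF that] b[OF that] by (simp add: q_def field_simps)
    moreover have "1 / q j * (1 / b j) \<le> 2 * 1"
      using q[OF that] b[OF that] by (intro mult_mono) (auto simp: field_simps)
    moreover have "0 \<le> 1 / q j * (1 / b j)" using q[OF that] b[OF that] by simp
    ultimately show "1 / b j \<le> 1 / q j" "1 / q j - 2 * eps \<le> 1 / b j"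
      using eps0 mult_left_mono[of "1 / q j * (1 / b j)" 2 eps] mult_nonneg_nonneg[of eps "1 / q j * (1 / b j)"]
      by linarith+
  qed
  have "(\<Sum>j\<in>Rm. (1 / b j)\<^sup>2) \<le> (\<Sum>j\<in>Rm. (1 / q j)\<^sup>2)"
    using sub inv_b b by (intro sum_mono power_mono) (force intro: order_trans[of 0 1])+
  also have "\<dots> \<le> 4 * N" using sqR sub by blast
  finally have "(\<Sum>j\<in>Rm. (1 / b j)\<^sup>2) \<le> 16 * real N" by simp
  moreover have "Rm \<subseteq> {..N}" "i0 \<le> N" using sub i0 by auto
  ultimately have ev3: "holds_except (iid N) (4 * exp (- t / (8 * sqrt N)))
    (\<lambda>x. \<bar>(\<Sum>j\<in>Rm. 1 / b j * x (i0, j)) - (\<Sum>j\<in>Rm. 1 / b j)\<bar> \<le> t)"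
    using N by (intro row_deviation) auto
  have "(\<Sum>j\<in>Rm. 1 / q j - 2 * eps) \<le> (\<Sum>j\<in>Rm. 1 / b j)"
    using sub inv_b by (intro sum_mono) auto
  moreover have "2 * eps * card Rm \<le> 2 * eps * real N"
    using sub card_mono[OF _ sub(5)] eps0 by (intro mult_left_mono) auto
  ultimately have mean: "stat_mean a b m n eps \<le> (\<Sum>i\<in>C1. 1 / p i) + (\<Sum>j\<in>R1. 1 / q j)
      + ((\<Sum>i\<in>C2. 1 / p i) + (\<Sum>j\<in>R2. 1 / q j)) + (\<Sum>j\<in>Rm. 1 / b j) + 2 * eps * real N + real N powr (1/10)"
    using splitC[of "\<lambda>i. 1 / p i"] splitR[of "\<lambda>j. 1 / q j"] i0 eps
    by (simp add: stat_mean_def p_def q_def sum_subtractf powr_minus_divide mult.commute)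
  note events = holds_except_conj[OF finite_measure_iid holds_except_AE[OF AE_iid_nonneg]
      holds_except_conj[OF finite_measure_iid ev1 holds_except_conj[OF finite_measure_iid ev2 ev3]]]
  show ?thesis
  proof (rule holds_except_mono[OF events], goal_cases)
    case (2 x)
    define W where "W = bulk (stat_weight a b {1..m} {1..n} x)"
    have W: "0 \<le> W i j" for i j
    proof -
      have "0 \<le> stat_weight p q {1..m} {1..n} x i j"
        using 2 p q eps0 by (intro stat_weight_nonneg[OF _ CR]) force+
      moreover have "W = bulk (stat_weight p q {1..m} {1..n} x)"
        unfolding W_def by (rule bulk_cong) (simp add: p_def q_def)
      ultimately show ?thesis by (simp add: bulk_def)
    qed
    \<comment> \<open>The condition \<open>i > i0 - 1\<close> keeps column \<open>i0\<close> itself,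
      since \<open>i0\<close> is at least 1. The second cut, at \<open>(i0, l2)\<close>, then
      separates column \<open>i0\<close> on the rows \<open>Rm\<close> from the upper block.\<close>
    let ?W2 = "\<lambda>i j. if i > i0 - 1 \<and> j > l1 then W i j else 0"
    have A: "(\<lambda>i j. if i \<le> i0 - 1 \<and> j \<le> l1 then W i j else 0) = bulk (stat_weight p q C1 R1 x)"
      using sub(1,3) i0 by (auto simp: fun_eq_iff W_def bulk_def stat_weight_def C1_def R1_def p_def q_def)
    have B: "(\<lambda>i j. if i > i0 \<and> j > l2 then ?W2 i j else 0) = bulk (stat_weight p q C2 R2 x)"
      using i0 \<open>l1 \<le> l2\<close> by (auto simp: fun_eq_iff W_def bulk_def stat_weight_def C2_def R2_def p_def q_def)
    have "lpp (bulk (stat_weight p q C1 R1 x)) N N + lpp ?W2 N N \<le> lpp W N N"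
      using lpp_concat[of W "i0 - 1" l1 N N, OF W] unfolding A .
    moreover have "lpp (\<lambda>i j. if i \<le> i0 \<and> j \<le> l2 then ?W2 i j else 0) N N
        + lpp (bulk (stat_weight p q C2 R2 x)) N N \<le> lpp ?W2 N N"
      using lpp_concat[of ?W2 i0 l2 N N] W unfolding B by simp
    moreover have "(\<Sum>j\<le>N. if i0 \<le> i0 \<and> j \<le> l2 then ?W2 i0 j else 0)
        \<le> lpp (\<lambda>i j. if i \<le> i0 \<and> j \<le> l2 then ?W2 i j else 0) N N"
      using W \<open>i0 \<le> N\<close> by (intro lpp_ge_column) auto
    moreover have "(\<Sum>j\<le>N. if i0 \<le> i0 \<and> j \<le> l2 then ?W2 i0 j else 0) = (\<Sum>j\<in>Rm. 1 / b j * x (i0, j))"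
      using sub(5) i0
      by (intro sum.mono_neutral_cong_right) (auto simp: W_def bulk_def stat_weight_def Rm_def l2_def)
    ultimately show ?case using 2 mean unfolding W_def[symmetric] by linarith
  qed simp
qed

end

context normalized
begin

lemma lower_bound:
  assumes i0: "i0 \<in> {1..m}" "a i0 = 0" and j0: "j0 \<in> {1..n}" "b j0 = 1"
    and eps: "eps = real N powr (-1/10)" "eps \<le> 1/2"
    and d: "d = real N powr (-3/10)" "2 * d \<le> eps"
    and gain: "6 * t + 4 * d + 16 * d\<^sup>2 * real N powr (1/10) * real N \<le> d * (L\<^sup>2 / real N)" "L \<ge> 0"
    and t: "t > 0"
  obtains z where "0 < z" "z < 1" "holds_except (iid N) (68 * exp (- t / (8 * sqrt N)))
    (\<lambda>x. stat_mean a b m n z - 7 * t - 2 * L - 3 * real N powr (1/10) - 2 * eps * real N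
      \<le> lpp (bulk (stat_weight a b {1..m} {1..n} x)) N N)"
proof -
  have eps0: "eps > 0" using mn unfolding eps(1) powr_gt_zero by linarith
  \<comment> \<open>\<open>Sa\<close> decreases and \<open>Sb\<close> increases in \<open>z\<close>,
    so the comparison at the two cut-offs tells whether the crossing lies near 0, near 1 or in
    between.\<close>
  consider "Sa eps \<le> Sb eps" | "Sb (1 - eps) \<le> Sa (1 - eps)"
    | "Sb eps \<le> Sa eps" "Sa (1 - eps) \<le> Sb (1 - eps)" by linarith
  then show ?thesis
  proof cases
    case 1
    show ?thesis
      by (rule that[OF _ _ edge_lower_bound[OF i0 eps 1 d gain t]]) (use eps0 eps in auto)
  next
    case 2
    \<comment> \<open>Exchanging rows and columns and replacing \<open>z\<close> by
      \<open>1 - z\<close> moves the end 1 to the end 0; the shifts by 1 turn the minima into 0 and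
      1 again.\<close>
    interpret T: normalized "\<lambda>j. b j - 1" "\<lambda>i. a i + 1" n m
      using mn a b by unfold_locales auto
    let ?S = "\<lambda>x. \<lambda>k\<in>{..N} \<times> {..N}. x (prod.swap k)"
    have "holds_except (iid N) (68 * exp (- t / (8 * sqrt N)))
      (\<lambda>x. stat_mean (\<lambda>j. b j - 1) (\<lambda>i. a i + 1) n m eps - 7 * t - 2 * L
          - 3 * real N powr (1/10) - 2 * eps * real N
        \<le> lpp (bulk (stat_weight (\<lambda>j. b j - 1) (\<lambda>i. a i + 1) {1..n} {1..m} x)) N N)"
      using T.edge_lower_bound[of j0 eps d t L] j0 eps d gain t 2
      by (simp add: add.commute[of n m] algebra_simps)
    moreover have "stat_mean (\<lambda>j. b j - 1) (\<lambda>i. a i + 1) n m eps = stat_mean a b m n (1 - eps)"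
      by (simp add: stat_mean_def algebra_simps)
    moreover have "bulk (stat_weight (\<lambda>j. b j - 1) (\<lambda>i. a i + 1) {1..n} {1..m} x)
        = bulk (stat_weight b a {1..n} {1..m} x)" for x
      by (rule bulk_cong) simp
    ultimately have "holds_except (iid N) (68 * exp (- t / (8 * sqrt N)))
      (\<lambda>x. stat_mean a b m n (1 - eps) - 7 * t - 2 * L - 3 * real N powr (1/10) - 2 * eps * real N
        \<le> lpp (bulk (stat_weight b a {1..n} {1..m} x)) N N)" by simp
    from holds_except_vimage[OF measure_preserving_transpose[unfolded measure_preserving_def, THEN conjunct1]
        measure_preserving_transpose[unfolded measure_preserving_def, THEN conjunct2] this]
    show ?thesis
      unfolding lpp_bulk_transpose[OF CR]
      by (rule that[of "1 - eps", rotated 2]) (use eps0 eps in auto)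
  next
    case 3
    obtain z where z: "0 < z" "z < 1" "holds_except (iid N) (32 * exp (- t / (8 * sqrt N)))
      (\<lambda>x. stat_mean a b m n z - 3 * t - L - real N powr (1/10)
        \<le> lpp (bulk (stat_weight a b {1..m} {1..n} x)) N N)"
      by (rule interior_lower_bound[OF eps 3 d gain t])
    have "0 \<le> real N powr (1/10)" "0 \<le> 2 * eps * real N" using eps0 by auto
    then have "3 * t + L + real N powr (1/10) \<le> 7 * t + 2 * L + 3 * real N powr (1/10) + 2 * eps * real N"
      using t gain(2) by linarith
    then show ?thesis
      by (intro that[OF z(1,2)] holds_except_mono[OF z(3)]) auto
  qed
qed

end

section \<open>Undoing the normalisation\<close>

lemma stat_weight_scale:
  assumes "c \<noteq> 0"
  shows "bulk (stat_weight (\<lambda>i. p i / c) (\<lambda>j. q j / c) C R x) = (\<lambda>i j. c * bulk (stat_weight p q C R x) i j)"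
  using assms by (auto simp: fun_eq_iff bulk_def stat_weight_def simp flip: add_divide_distrib)

text \<open>Adding \<open>\<mu>\<close> to the parameter and dividing by \<open>D\<close> maps the
  interval to \<open>(0, 1)\<close>. Passage times and means are both multiplied by
  \<open>D\<close>, so errors of the normalised model are divided by \<open>D\<close> on the way
  back. The tails 8 and 68 add up to 76.\<close>

lemma passage_bounds:
  assumes mn: "m \<ge> 1" "n \<ge> 1"
    and adm: "\<And>i j. i \<in> {1..m} \<Longrightarrow> j \<in> {1..n} \<Longrightarrow> 0 < a m i + b n j"
    and N: "N = m + n"
    and eps: "eps = real N powr (-1/10)" "eps \<le> 1/2"
    and d: "d = real N powr (-3/10)" "2 * d \<le> eps"
    and gain: "6 * t + 4 * d + 16 * d\<^sup>2 * real N powr (1/10) * real N \<le> d * (L\<^sup>2 / real N)" "L \<ge> 0"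
    and t: "t > 0"
  defines "G \<equiv> \<lambda>x. lpp (bulk (stat_weight (a m) (b n) {1..m} {1..n} x)) N N"
  shows "holds_except (iid N) (76 * exp (- t / (8 * sqrt N)))
    (\<lambda>x. G x \<le> M_center a b m n + inverse (I_length a b m n) * (2 * t) \<and>
      M_center a b m n - inverse (I_length a b m n) * (7 * t + 2 * L + 3 * real N powr (1/10) + 2 * eps * real N) \<le> G x)"
proof -
  define \<mu> where "\<mu> = row_min a m"
  define \<nu> where "\<nu> = row_min b n"
  define D where "D = \<mu> + \<nu>"
  have D_eq: "I_length a b m n = D" by (simp add: I_length_def D_def \<mu>_def \<nu>_def)
  have "\<mu> \<in> a m ` {1..m}" "\<nu> \<in> b n ` {1..n}"
    unfolding \<mu>_def \<nu>_def row_min_def using mn by (auto intro!: Min_in)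
  then obtain i0 j0 where i0: "i0 \<in> {1..m}" "a m i0 = \<mu>" and j0: "j0 \<in> {1..n}" "b n j0 = \<nu>"
    by auto
  have min: "\<And>i. i \<in> {1..m} \<Longrightarrow> \<mu> \<le> a m i" "\<And>j. j \<in> {1..n} \<Longrightarrow> \<nu> \<le> b n j"
    unfolding \<mu>_def \<nu>_def row_min_def by auto
  have D: "D > 0" using adm[OF i0(1) j0(1)] i0 j0 by (simp add: D_def)
  define a' where "a' i = (a m i - \<mu>) / D" for i
  define b' where "b' j = (b n j + \<mu>) / D" for j
  interpret X: normalized a' b' m n
    using mn min D by unfold_locales (auto simp: a'_def b'_def D_def)
  have i0': "a' i0 = 0" and j0': "b' j0 = 1"
    using i0 j0 D by (auto simp: a'_def b'_def D_def)
  define F where "F z = stat_mean (a m) (b n) m n z" for z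
  have M: "M_center a b m n = (INF z\<in>{-\<mu><..<\<nu>}. F z)"
    by (simp add: M_center_def I_set_def F_def stat_mean_def \<mu>_def \<nu>_def)
  have mean: "stat_mean a' b' m n w = D * F (D * w - \<mu>)" for w
  proof -
    have "a' i + w = (a m i + (D * w - \<mu>)) / D" "b' j - w = (b n j - (D * w - \<mu>)) / D" for i j
      using D by (auto simp: a'_def b'_def field_simps)
    then show ?thesis
      by (simp add: stat_mean_def F_def sum_distrib_left distrib_left)
  qed
  have F_nonneg: "0 \<le> F z" if "z \<in> {-\<mu><..<\<nu>}" for z
  proof -
    have "0 \<le> a m i + z" if "i \<in> {1..m}" for i using min(1)[OF that] \<open>z \<in> _\<close> by simp
    moreover have "0 \<le> b n j - z" if "j \<in> {1..n}" for j using min(2)[OF that] \<open>z \<in> _\<close> by simp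
    ultimately show ?thesis
      unfolding F_def stat_mean_def by (intro add_nonneg_nonneg sum_nonneg) auto
  qed
  have M_le: "M_center a b m n \<le> F z" if "z \<in> {-\<mu><..<\<nu>}" for z
    unfolding M using that F_nonneg by (intro cINF_lower bdd_belowI2[where m = 0]) auto
  have in_I: "D * w - \<mu> \<in> {-\<mu><..<\<nu>}" if "0 < w" "w < 1" for w
  proof -
    have "0 < D * w" "D * w < D * 1" using that D by (simp, intro mult_strict_left_mono)
    then show ?thesis unfolding greaterThanLessThan_iff using D_def by (intro conjI) linarith+
  qed
  have G: "lpp (bulk (stat_weight a' b' {1..m} {1..n} x)) N N = D * G x" for x
  proof -
    have "bulk (stat_weight a' b' {1..m} {1..n} x)
        = bulk (stat_weight (\<lambda>i. a m i / D) (\<lambda>j. b n j / D) {1..m} {1..n} x)"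
      by (rule bulk_cong) (simp add: a'_def b'_def flip: add_divide_distrib)
    then show ?thesis
      using D by (simp add: stat_weight_scale G_def lpp_scale)
  qed
  obtain z where z: "0 < z" "z < 1"
      "\<And>w. 0 < w \<Longrightarrow> w < 1 \<Longrightarrow> stat_mean a' b' m n z \<le> stat_mean a' b' m n w"
    and up0: "holds_except (iid (m + n)) (8 * exp (- t / (8 * sqrt (real (m + n)))))
      (\<lambda>x. lpp (bulk (stat_weight a' b' {1..m} {1..n} x)) (m + n) (m + n) \<le> stat_mean a' b' m n z + 2 * t)"
    using X.upper_bound[where t = t, OF i0(1) i0' j0(1) j0'] by blast
  note up = up0[folded N, unfolded G mean]
  \<comment> \<open>The minimiser of the normalised mean corresponds to one of \<open>F\<close> on
    the original interval, so the centre of the upper bound does not exceed the infimum.\<close>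
  have "F (D * z - \<mu>) \<le> M_center a b m n"
    unfolding M
  proof (rule cINF_greatest)
    show "{-\<mu><..<\<nu>} \<noteq> {}" using D by (auto simp: D_def)
    fix y assume y: "y \<in> {-\<mu><..<\<nu>}"
    have "0 < (y + \<mu>) / D" "(y + \<mu>) / D < 1" using y D by (auto simp: D_def)
    from z(3)[OF this] show "F (D * z - \<mu>) \<le> F y" using D by (simp add: mean)
  qed
  then have "D * F (D * z - \<mu>) \<le> D * M_center a b m n" using D by simp
  then have up': "holds_except (iid N) (8 * exp (- t / (8 * sqrt N)))
      (\<lambda>x. G x \<le> M_center a b m n + inverse D * (2 * t))"
  proof (intro holds_except_mono[OF up], goal_cases)
    case (2 x)
    then have "D * G x \<le> D * M_center a b m n + 2 * t" by linarith
    then show ?case using D by (simp add: field_simps)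
  qed simp
  obtain w where w: "0 < w" "w < 1"
    and low0: "holds_except (iid (m + n)) (68 * exp (- t / (8 * sqrt (real (m + n)))))
      (\<lambda>x. stat_mean a' b' m n w - 7 * t - 2 * L - 3 * real (m + n) powr (1/10) - 2 * eps * real (m + n)
        \<le> lpp (bulk (stat_weight a' b' {1..m} {1..n} x)) (m + n) (m + n))"
    by (rule X.lower_bound[OF i0(1) i0' j0(1) j0' eps[unfolded N] d[unfolded N] gain[unfolded N] t])
  note low = low0[folded N, unfolded G mean]
  \<comment> \<open>The infimum is at most the value at any point of the interval, so for the lower
    bound \<open>w\<close> may lie anywhere in it.\<close>
  have "D * M_center a b m n \<le> D * F (D * w - \<mu>)"
    using M_le[OF in_I[OF w]] D by simp
  then have low': "holds_except (iid N) (68 * exp (- t / (8 * sqrt N)))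
    (\<lambda>x. M_center a b m n - inverse D * (7 * t + 2 * L + 3 * real N powr (1/10) + 2 * eps * real N) \<le> G x)"
  proof (intro holds_except_mono[OF low], goal_cases)
    case (2 x)
    then have "D * M_center a b m n - (7 * t + 2 * L + 3 * real N powr (1/10) + 2 * eps * real N) \<le> D * G x"
      by linarith
    then show ?case using D by (simp add: field_simps)
  qed simp
  show ?thesis
    unfolding D_eq
    by (rule holds_except_mono[OF holds_except_conj[OF finite_measure_iid up' low']]) auto
qed

section \<open>Up-right paths and the law of the weights\<close>

lemma up_right_path_coords:
  assumes "\<pi> \<noteq> []" "hd \<pi> = (1, 1)" "successively up_right_step \<pi>" "v \<in> set \<pi>"
  shows "1 \<le> fst v \<and> 1 \<le> snd v \<and> fst v \<le> fst (last \<pi>) \<and> snd v \<le> snd (last \<pi>)"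
  using assms
proof (induction \<pi> arbitrary: v rule: rev_induct)
  case (snoc u \<pi>)
  show ?case
  proof (cases "\<pi> = []")
    case False
    then have step: "up_right_step (last \<pi>) u" and IH: "\<And>v. v \<in> set \<pi> \<Longrightarrow>
        1 \<le> fst v \<and> 1 \<le> snd v \<and> fst v \<le> fst (last \<pi>) \<and> snd v \<le> snd (last \<pi>)"
      using snoc by (auto simp: successively_append_iff)
    show ?thesis
      using step IH[of v] IH[of "last \<pi>"] False snoc.prems(4) by (auto simp: up_right_step_def)
  qed (use snoc in auto)
qed simp

lemma up_right_paths_boundary: "up_right_paths 0 j = {}" "up_right_paths i 0 = {}"
proof -
  have "1 \<le> i \<and> 1 \<le> j" if "\<pi> \<in> up_right_paths i j" for \<pi> i j
    using that up_right_path_coords[of \<pi> "last \<pi>"] last_in_set[of \<pi>]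
    by (auto simp: up_right_paths_def)
  from this[of _ 0 j] this[of _ i 0] show "up_right_paths 0 j = {}" "up_right_paths i 0 = {}"
    by auto
qed

lemma up_right_paths_rec:
  assumes "(i, j) \<noteq> (1, 1)" "i \<ge> 1" "j \<ge> 1"
  shows "up_right_paths i j
    = (\<lambda>\<pi>. \<pi> @ [(i, j)]) ` (up_right_paths (i - 1) j \<union> up_right_paths i (j - 1))"
proof (intro equalityI subsetI)
  fix \<pi> assume \<pi>: "\<pi> \<in> up_right_paths i j"
  then obtain \<rho> where \<rho>: "\<pi> = \<rho> @ [(i, j)]"
    by (cases \<pi> rule: rev_cases) (auto simp: up_right_paths_def)
  moreover have "\<rho> \<noteq> []" using \<pi> assms \<rho> by (auto simp: up_right_paths_def)
  ultimately have "hd \<rho> = (1, 1)" "successively up_right_step \<rho>" "up_right_step (last \<rho>) (i, j)"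
    using \<pi> by (auto simp: up_right_paths_def successively_append_iff)
  then have "\<rho> \<in> up_right_paths (i - 1) j \<union> up_right_paths i (j - 1)"
    using \<open>\<rho> \<noteq> []\<close> by (cases "last \<rho>") (auto simp: up_right_paths_def up_right_step_def)
  then show "\<pi> \<in> (\<lambda>\<pi>. \<pi> @ [(i, j)]) ` (up_right_paths (i - 1) j \<union> up_right_paths i (j - 1))"
    using \<rho> by blast
next
  fix \<pi> assume "\<pi> \<in> (\<lambda>\<pi>. \<pi> @ [(i, j)]) ` (up_right_paths (i - 1) j \<union> up_right_paths i (j - 1))"
  then show "\<pi> \<in> up_right_paths i j"
    using assms by (auto simp: up_right_paths_def successively_append_iff up_right_step_def)
qed

lemma up_right_paths_1: "up_right_paths 1 1 = {[(1, 1)]}"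
proof (intro equalityI subsetI)
  fix \<pi> assume \<pi>: "\<pi> \<in> up_right_paths 1 1"
  then obtain \<rho> where \<rho>: "\<pi> = \<rho> @ [(1, 1)]"
    by (cases \<pi> rule: rev_cases) (auto simp: up_right_paths_def)
  have "\<rho> = []"
  proof (rule ccontr)
    assume "\<rho> \<noteq> []"
    then have "up_right_step (last \<rho>) (1, 1)" "hd \<rho> = (1, 1)" "successively up_right_step \<rho>"
      using \<pi> \<rho> by (auto simp: up_right_paths_def successively_append_iff)
    with up_right_path_coords[OF \<open>\<rho> \<noteq> []\<close> this(2,3), of "last \<rho>"] \<open>\<rho> \<noteq> []\<close> show False
      by (auto simp: up_right_step_def)
  qed
  with \<rho> show "\<pi> \<in> {[(1, 1)]}" by simp
qed (simp add: up_right_paths_def)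

text \<open>Induction on \<open>i + j\<close> by the last step of a path, which is the recursion of
  \<open>lpp\<close>. Finiteness and nonemptiness are carried along so that the laws of
  \<open>Max\<close> apply.\<close>

lemma last_passage_eq_lpp:
  assumes W: "\<And>i j. i \<ge> 1 \<Longrightarrow> j \<ge> 1 \<Longrightarrow> 0 \<le> W i j" and "i \<ge> 1" "j \<ge> 1"
  shows "finite (up_right_paths i j) \<and> up_right_paths i j \<noteq> {} \<and> last_passage W i j = lpp (bulk W) i j"
  using assms(2,3)
proof (induction "i + j" arbitrary: i j rule: less_induct)
  case less
  define S where "S \<pi> = (\<Sum>(i, j)\<in>set \<pi>. W i j)" for \<pi>
  have LP: "last_passage W i j = Max (S ` up_right_paths i j)" for i j
    by (simp add: last_passage_def S_def)
  have nonneg: "0 \<le> bulk W i j" for i j using W by (simp add: bulk_def)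
  have lpp_nonneg: "0 \<le> lpp (bulk W) i j" for i j by (rule lpp_nonneg) (rule nonneg)
  have zero: "lpp (bulk W) i 0 = 0" "lpp (bulk W) 0 j = 0" for i j
    by (auto simp: lpp_col lpp_row bulk_def)
  obtain i' j' where ij: "i = Suc i'" "j = Suc j'" using less.prems by (cases i; cases j) auto
  show ?case
  proof (cases "(i, j) = (1, 1)")
    case True
    then show ?thesis
      using up_right_paths_1 by (simp add: LP S_def lpp.simps(4) zero bulk_def)
  next
    case False
    let ?A = "up_right_paths i' j" and ?B = "up_right_paths i j'"
    have rec: "up_right_paths i j = (\<lambda>\<pi>. \<pi> @ [(i, j)]) ` (?A \<union> ?B)"
      using up_right_paths_rec[OF False less.prems] ij by simp
    \<comment> \<open>The sum runs over the set of sites, so the last site must not occur earlier;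
      the monotone coordinates of a path exclude this.\<close>
    have S_snoc: "S (\<pi> @ [(i, j)]) = S \<pi> + W i j" if "\<pi> \<in> ?A \<union> ?B" for \<pi>
    proof -
      have "(i, j) \<notin> set \<pi>"
        using that up_right_path_coords[of \<pi> "(i, j)"] ij by (auto simp: up_right_paths_def)
      then show ?thesis by (simp add: S_def add.commute)
    qed
    have A: "finite ?A \<and> (i' \<noteq> 0 \<longrightarrow> ?A \<noteq> {} \<and> Max (S ` ?A) = lpp (bulk W) i' j)"
      using less.hyps[of i' j] less.prems ij up_right_paths_boundary LP by (cases "i' = 0") auto
    have B: "finite ?B \<and> (j' \<noteq> 0 \<longrightarrow> ?B \<noteq> {} \<and> Max (S ` ?B) = lpp (bulk W) i j')"
      using less.hyps[of i j'] less.prems ij up_right_paths_boundary LP by (cases "j' = 0") auto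
    have ne: "?A \<union> ?B \<noteq> {}" using A B False ij by auto
    have "Max (S ` (?A \<union> ?B)) = max (lpp (bulk W) i' j) (lpp (bulk W) i j')"
    proof -
      \<comment> \<open>At the edge of the quadrant one of the two path sets is empty, while
        \<open>lpp (bulk W)\<close> is 0 there and does not affect the maximum with a nonnegative
        number.\<close>
      consider "i' = 0" "j' \<noteq> 0" | "j' = 0" "i' \<noteq> 0" | "i' \<noteq> 0" "j' \<noteq> 0" using False ij by auto
      then show ?thesis
      proof cases
        case 1
        then show ?thesis using B lpp_nonneg[of i j'] by (simp add: up_right_paths_boundary zero)
      next
        case 2
        then show ?thesis using A lpp_nonneg[of i' j] by (simp add: up_right_paths_boundary zero)
      next
        case 3
        then show ?thesis using A B by (simp add: image_Un Max_Un)
      qed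
    qed
    moreover have "last_passage W i j = Max ((\<lambda>\<pi>. S \<pi> + W i j) ` (?A \<union> ?B))"
      unfolding LP rec image_image using S_snoc by (intro arg_cong[of _ _ Max] image_cong) auto
    moreover have "\<dots> = Max (S ` (?A \<union> ?B)) + W i j"
      using A B ne by (intro Max_add_commute) auto
    moreover have "lpp (bulk W) i j = W i j + max (lpp (bulk W) i' j) (lpp (bulk W) i j')"
      by (simp add: ij lpp.simps(4) bulk_def)
    moreover have "finite (up_right_paths i j)" "up_right_paths i j \<noteq> {}"
      using A B ne unfolding rec by auto
    ultimately show ?thesis by simp
  qed
qed

text \<open>Paths stay in the rectangle, so the weights outside may be set to 0; zero columns and
  rows then extend the rectangle to the square underlying \<open>iid N\<close>.\<close>

lemma last_passage_eq_bulk: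
  assumes W: "\<And>i j. i \<in> {1..m} \<Longrightarrow> j \<in> {1..n} \<Longrightarrow> 0 \<le> W i j" and mn: "m \<ge> 1" "n \<ge> 1"
    and N: "m \<le> N" "n \<le> N"
  shows "last_passage W m n = lpp (\<lambda>i j. if i \<in> {1..m} \<and> j \<in> {1..n} then W i j else 0) N N"
proof -
  define V where "V = (\<lambda>i j. if i \<in> {1..m} \<and> j \<in> {1..n} then W i j else 0)"
  have V: "0 \<le> V i j" for i j using W by (simp add: V_def)
  have "(\<Sum>(i, j)\<in>set \<pi>. W i j) = (\<Sum>(i, j)\<in>set \<pi>. V i j)" if "\<pi> \<in> up_right_paths m n" for \<pi>
    using that up_right_path_coords[of \<pi>]
    by (intro sum.cong refl) (fastforce simp: up_right_paths_def V_def)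
  then have "last_passage W m n = last_passage V m n"
    unfolding last_passage_def by (intro arg_cong[of _ _ Max] image_cong) auto
  also have "\<dots> = lpp (bulk V) m n"
    using last_passage_eq_lpp[of V m n] V mn by simp
  also have "bulk V = V" by (auto simp: bulk_def V_def fun_eq_iff)
  also have "lpp V m n = lpp V N n"
    using N(1)
  proof (induction rule: dec_induct)
    case (step k)
    have "V (Suc k) j = 0" for j using step by (simp add: V_def)
    then show ?case using step lpp_skip_column[of V k n, OF V] by simp
  qed simp
  also have "lpp V N n = lpp V N N"
  proof -
    have "lpp V N n = lpp V N k" if "n \<le> k" for k
      using that
    proof (induction rule: dec_induct)
      case (step k)
      have "V i (Suc k) = 0" for i using step by (simp add: V_def)
      then show ?case using step lpp_skip_row[of V k N, OF V] by simp
    qed simp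
    from this[OF N(2)] show ?thesis .
  qed
  finally show ?thesis unfolding V_def .
qed

section \<open>Transfer to weights with a prescribed law\<close>

lemma holds_except_transfer:
  assumes X: "X \<in> measurable M S" and Y: "Y \<in> measurable M' S" and law: "distr M S X = distr M' S Y"
    and P: "{s \<in> space S. P s} \<in> sets S" and "finite_measure M'"
    and ev: "holds_except M' e (\<lambda>y. P (Y y))"
  shows "holds_except M e (\<lambda>x. P (X x))"
proof -
  interpret M': finite_measure M' by fact
  \<comment> \<open>The failure set in the target space has the same mass under both laws, and its
    preimage under \<open>Y\<close> lies in the exceptional set \<open>A\<close>. Its preimage under
    \<open>X\<close> is the new exceptional set.\<close>
  define B where "B = {s \<in> space S. \<not> P s}"
  have B: "B \<in> sets S" using sets.compl_sets[OF P] by (simp add: B_def set_diff_eq Collect_conj_eq[symmetric] conj_commute cong: conj_cong)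
  from ev obtain A where A: "A \<in> sets M'" "measure M' A \<le> e" "\<forall>y\<in>space M'. y \<notin> A \<longrightarrow> P (Y y)"
    unfolding holds_except_def by blast
  have "measure M (X -` B \<inter> space M) = measure (distr M S X) B"
    using X B by (simp add: measure_distr)
  also have "\<dots> = measure M' (Y -` B \<inter> space M')"
    unfolding law using Y B by (simp add: measure_distr)
  also have "\<dots> \<le> measure M' A"
    using A by (intro M'.finite_measure_mono) (auto simp: B_def)
  finally show ?thesis
    unfolding holds_except_def using A(2) X B
    by (intro bexI[of _ "X -` B \<inter> space M"]) (auto simp: B_def measurable_sets dest: measurable_space)
qed

lemma borel_measurable_lpp:
  assumes "\<And>i j. (\<lambda>x. W x i j) \<in> borel_measurable M"
  shows "(\<lambda>x. lpp (W x) m n) \<in> borel_measurable M"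
proof (induction m n rule: grid_induct)
  case (4 i j)
  with assms show ?case unfolding lpp.simps by measurable
qed (use assms in simp_all)

lemma distr_exp_measure_divide:
  assumes r: "r > 0"
  shows "distr (exp_measure 1) borel (\<lambda>x. x / r) = exp_measure r"
proof (rule measure_eqI)
  fix A :: "real set" assume "A \<in> sets (distr (exp_measure 1) borel (\<lambda>x. x / r))"
  then have A: "A \<in> sets borel" by simp
  have "emeasure (distr (exp_measure 1) borel (\<lambda>x. x / r)) A
      = (\<integral>\<^sup>+y. indicator A y \<partial>distr (exp_measure 1) borel (\<lambda>x. x / r))"
    using A by simp
  also have "\<dots> = (\<integral>\<^sup>+x. indicator A (x / r) \<partial>exp_measure 1)"
    using A by (intro nn_integral_distr) auto
  also have "\<dots> = emeasure (exp_measure r) A"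
    using A r by (subst nn_integral_exp_measure_scale) auto
  finally show "emeasure (distr (exp_measure 1) borel (\<lambda>x. x / r)) A = emeasure (exp_measure r) A" .
qed simp

lemma (in prob_space) indep_exponential_law:
  assumes "indep_vars (\<lambda>_. borel) X K" "K \<noteq> {}" "\<And>k. k \<in> K \<Longrightarrow> distr M borel (X k) = exp_measure (r k)"
  shows "distr M (PiM K (\<lambda>_. borel)) (\<lambda>x. \<lambda>k\<in>K. X k x) = PiM K (\<lambda>k. exp_measure (r k))"
proof -
  have "random_variable borel (X k)" if "k \<in> K" for k
    using assms(1) that by (simp add: indep_vars_def)
  then have "distr M (PiM K (\<lambda>_. borel)) (\<lambda>x. \<lambda>k\<in>K. X k x) = PiM K (\<lambda>k. distr M borel (X k))"
    using indep_vars_iff_distr_eq_PiM'[where I = K and X = X and M' = "\<lambda>_. borel"] assms(1,2) by simp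
  also have "\<dots> = PiM K (\<lambda>k. exp_measure (r k))"
    by (intro PiM_cong refl assms)
  finally show ?thesis .
qed

lemma measurable_iid_component:
  assumes "k \<in> {..N} \<times> {..N}"
  shows "(\<lambda>x. x k) \<in> borel_measurable (iid N)"
  using measurable_component_singleton[OF assms, of "\<lambda>_. exp_measure 1"]
  unfolding iid_def by (simp cong: measurable_cong_sets)

lemma distr_iid_component:
  assumes "k \<in> {..N} \<times> {..N}"
  shows "distr (iid N) borel (\<lambda>x. x k) = exp_measure 1"
proof -
  have "distr (iid N) borel (\<lambda>x. x k) = distr (iid N) (exp_measure 1) (\<lambda>x. x k)"
    by (rule distr_cong) auto
  also have "\<dots> = exp_measure 1"
    unfolding iid_def using assms by (intro distr_PiM_component) (auto intro: prob_space_exp_measure)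
  finally show ?thesis .
qed

lemma indep_vars_iid: "prob_space.indep_vars (iid N) (\<lambda>_. borel) (\<lambda>k x. x k) ({..N} \<times> {..N})"
proof -
  interpret prob_space "iid N" by (rule prob_space_iid)
  let ?K = "{..N} \<times> {..N}"
  have "distr (iid N) (PiM ?K (\<lambda>_. borel)) (\<lambda>x. \<lambda>k\<in>?K. x k) = distr (iid N) (iid N) (\<lambda>x. x)"
  proof (rule distr_cong)
    show "sets (PiM ?K (\<lambda>_. borel :: real measure)) = sets (iid N)"
      unfolding iid_def by (intro sets_PiM_cong) auto
    show "(\<lambda>k\<in>?K. x k) = x" if "x \<in> space (iid N)" for x
      using that unfolding iid_def space_PiM by (intro extensional_restrict) (auto simp: PiE_def)
  qed simp
  also have "\<dots> = (PiM ?K (\<lambda>_. exp_measure 1))" by (simp add: iid_def)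
  also have "\<dots> = PiM ?K (\<lambda>k. distr (iid N) borel (\<lambda>x. x k))"
    by (intro PiM_cong refl distr_iid_component[symmetric])
  finally show ?thesis
    by (subst indep_vars_iff_distr_eq_PiM') (auto intro: measurable_iid_component)
qed

lemma distr_iid_divide:
  assumes K: "K \<subseteq> {..N} \<times> {..N}" "K \<noteq> {}" and r: "\<And>k. k \<in> K \<Longrightarrow> r k > 0"
  shows "distr (iid N) (PiM K (\<lambda>_. borel)) (\<lambda>x. \<lambda>k\<in>K. x k / r k) = PiM K (\<lambda>k. exp_measure (r k))"
proof -
  interpret prob_space "iid N" by (rule prob_space_iid)
  have meas: "random_variable borel (\<lambda>x. x k)" if "k \<in> K" for k
    using that K(1) by (intro measurable_iid_component) auto
  have "distr (iid N) borel (\<lambda>x. x k / r k) = exp_measure (r k)" if "k \<in> K" for k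
  proof -
    have "distr (iid N) borel (\<lambda>x. x k / r k) = distr (distr (iid N) borel (\<lambda>x. x k)) borel (\<lambda>y. y / r k)"
      using meas[OF that] by (subst distr_distr) (auto simp: comp_def)
    also have "\<dots> = exp_measure (r k)"
      using distr_iid_component[of k N] K(1) that r[OF that] distr_exp_measure_divide[of "r k"] by auto
    finally show ?thesis .
  qed
  then show ?thesis
    using indep_vars_compose2[OF indep_vars_subset[OF indep_vars_iid K(1)], of "\<lambda>k y. y / r k" "\<lambda>_. borel"] K(2)
    by (intro indep_exponential_law) auto
qed

lemma distributed_exponential:
  assumes "distributed M lborel X (exponential_density l)"
  shows "distr M borel X = exp_measure l" "X \<in> borel_measurable M"
    "l > 0 \<Longrightarrow> AE x in M. 0 \<le> X x"
proof -
  show X: "X \<in> borel_measurable M" using distributed_measurable[OF assms] by simp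
  have "distr M borel X = distr M lborel X" by (rule distr_cong) auto
  then show law: "distr M borel X = exp_measure l"
    using distributed_distr_eq_density[OF assms] by (simp add: exp_measure_def)
  have "AE y in exp_measure l. 0 \<le> y"
    unfolding exp_measure_def by (subst AE_density) (auto simp: exponential_density_def)
  then show "AE x in M. 0 \<le> X x" unfolding law[symmetric] by (intro AE_distrD[OF X])
qed

lemma prob_space_base_measure: "prob_space base_measure"
  unfolding base_measure_def by (intro prob_space_PiM prob_space_exp_measure) simp

text \<open>For fixed \<open>(m, n)\<close> the passage time is a measurable function of the weights
  of that rectangle, whose joint law is that of scaled rate-one coordinates, so estimates on
  \<open>iid N\<close> carry over.\<close>

lemma weights_transfer:
  fixes \<omega> :: "nat \<Rightarrow> nat \<Rightarrow> nat \<Rightarrow> nat \<Rightarrow> (nat \<times> nat \<Rightarrow> real) \<Rightarrow> real"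
  assumes adm: "admissible a b" and wts: "exponential_weights base_measure a b \<omega>"
    and mn: "m \<ge> 1" "n \<ge> 1" and N: "N = m + n"
    and ev: "holds_except (iid N) e (\<lambda>x. lpp (bulk (stat_weight (a m) (b n) {1..m} {1..n} x)) N N \<in> A)"
    and A: "A \<in> sets borel"
  shows "holds_except base_measure e (\<lambda>x. last_passage (\<lambda>i j. \<omega> m n i j x) m n \<in> A)"
proof -
  interpret P: prob_space base_measure by (rule prob_space_base_measure)
  interpret I: prob_space "iid N" by (rule prob_space_iid)
  define K where "K = {1..m} \<times> {1..n}"
  define r where "r = (\<lambda>(i, j). a m i + b n j)"
  define X where "X = (\<lambda>(i, j). \<omega> m n i j)"
  define S :: "(nat \<times> nat \<Rightarrow> real) measure" where "S = PiM K (\<lambda>_. borel)"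
  define g where "g y = lpp (\<lambda>i j. if (i, j) \<in> K then y (i, j) else 0) N N" for y :: "nat \<times> nat \<Rightarrow> real"
  have K: "K \<subseteq> {..N} \<times> {..N}" "K \<noteq> {}" "finite K" using mn N by (auto simp: K_def)
  have r: "r k > 0" if "k \<in> K" for k
    using that adm mn by (auto simp: K_def r_def admissible_def)
  have indep: "P.indep_vars (\<lambda>_. borel) X K"
    and dist: "distributed base_measure lborel (X k) (exponential_density (r k))" if "k \<in> K" for k
    using wts mn that by (auto simp: exponential_weights_def X_def K_def r_def)
  have X_meas: "X k \<in> borel_measurable base_measure" if "k \<in> K" for k
    by (rule distributed_exponential(2)[OF dist[OF that]])
  \<comment> \<open>The identification with \<open>lpp\<close> rests on nonnegative weights, which
    are available only almost surely; the null set joins the exceptional set.\<close>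
  have "AE x in base_measure. \<forall>k\<in>K. 0 \<le> X k x"
    using K(3) distributed_exponential(3)[OF dist r] by (intro AE_finite_allI) auto
  then have nonneg: "holds_except base_measure 0 (\<lambda>x. \<forall>k\<in>K. 0 \<le> X k x)"
    by (rule holds_except_AE)
  have g: "g \<in> borel_measurable S"
    unfolding g_def
  proof (rule borel_measurable_lpp)
    fix i j show "(\<lambda>y. if (i, j) \<in> K then y (i, j) else 0) \<in> borel_measurable S"
      unfolding S_def by (cases "(i, j) \<in> K") auto
  qed
  have "holds_except base_measure e (\<lambda>x. g (\<lambda>k\<in>K. X k x) \<in> A)"
  proof (rule holds_except_transfer[where S = S and M' = "iid N" and Y = "\<lambda>x. \<lambda>k\<in>K. x k / r k"
        and P = "\<lambda>y. g y \<in> A" and X = "\<lambda>x. \<lambda>k\<in>K. X k x"])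
    show "(\<lambda>x. \<lambda>k\<in>K. X k x) \<in> measurable base_measure S"
      unfolding S_def by (intro measurable_restrict X_meas)
    show "(\<lambda>x. \<lambda>k\<in>K. x k / r k) \<in> measurable (iid N) S"
      unfolding S_def using K
      by (intro measurable_restrict borel_measurable_divide measurable_iid_component) auto
    show "distr base_measure S (\<lambda>x. \<lambda>k\<in>K. X k x) = distr (iid N) S (\<lambda>x. \<lambda>k\<in>K. x k / r k)"
      unfolding S_def using distr_iid_divide[OF K(1,2) r] K(2)
        P.indep_exponential_law[of X K r] indep distributed_exponential(1)[OF dist] by fastforce
    show "{y \<in> space S. g y \<in> A} \<in> sets S"
      using measurable_sets[OF g A] by (simp add: vimage_def Int_def conj_commute)
    have "bulk (stat_weight (a m) (b n) {1..m} {1..n} x)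
        = (\<lambda>i j. if (i, j) \<in> K then (\<lambda>k\<in>K. x k / r k) (i, j) else 0)" for x
      by (auto simp: fun_eq_iff bulk_def stat_weight_def K_def r_def)
    then show "holds_except (iid N) e (\<lambda>x. g (\<lambda>k\<in>K. x k / r k) \<in> A)"
      using ev by (simp add: g_def)
  qed (rule finite_measure_iid)
  note both = holds_except_conj[OF P.finite_measure_axioms nonneg this]
  show ?thesis
  proof (rule holds_except_mono[OF both], goal_cases)
    case (2 x)
    have "last_passage (\<lambda>i j. \<omega> m n i j x) m n
        = lpp (\<lambda>i j. if i \<in> {1..m} \<and> j \<in> {1..n} then \<omega> m n i j x else 0) N N"
      using 2 mn N by (intro last_passage_eq_bulk) (auto simp: K_def X_def)
    also have "\<dots> = g (\<lambda>k\<in>K. X k x)"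
      by (auto simp: g_def K_def X_def intro!: lpp_cong)
    finally show ?case using 2 by simp
  qed simp
qed

section \<open>Summation over all rectangles\<close>

lemma eventually_passage_estimates:
  fixes e :: real
  assumes "e > 0"
  shows "\<forall>\<^sub>F N in sequentially. real N powr (-1/10) \<le> 1/2 \<and>
    2 * real N powr (1/2 + e) \<le> real N powr (1/2 + 2 * e) \<and>
    7 * real N powr (1/2 + e) + 2 * real N powr (9/10 + e) + 3 * real N powr (1/10)
      + 2 * real N powr (-1/10) * real N \<le> real N powr (9/10 + 2 * e)"
  \<comment> \<open>The leading terms of the lower bound are \<open>2 * N powr (9/10 + e)\<close>
    from \<open>L\<close> and \<open>2 * N powr (9/10)\<close> from the edge loss; the extra
    \<open>e\<close> in the exponent absorbs the constants.\<close>
  using assms by (intro eventually_conj; real_asymp)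

text \<open>The factor \<open>N\<close> bounds the number of rectangles with
  \<open>m + n = N\<close>; the exponent is \<open>- (N powr e) / 8\<close>, whose exponential beats
  every power of \<open>N\<close>.\<close>

lemma summable_tail:
  fixes e :: real
  assumes "e > 0"
  shows "summable (\<lambda>N. real N * (76 * exp (- (real N powr (1/2 + e)) / (8 * sqrt N))))"
proof (rule summable_comparison_test_ev)
  have "\<forall>\<^sub>F N in sequentially. real N * (76 * exp (- (real N powr (1/2 + e)) / (8 * sqrt N))) \<le> inverse (real N ^ 2)"
    using assms by real_asymp
  then show "\<forall>\<^sub>F N in sequentially. norm (real N * (76 * exp (- (real N powr (1/2 + e)) / (8 * sqrt N))))
      \<le> inverse (real N ^ 2)"
    by simp
  show "summable (\<lambda>N. inverse (real N ^ 2))"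
    by (rule inverse_power_summable) simp
qed

theorem theorem3p2:
  fixes a b :: "nat \<Rightarrow> nat \<Rightarrow> real"
    and \<omega> :: "nat \<Rightarrow> nat \<Rightarrow> nat \<Rightarrow> nat \<Rightarrow> (nat \<times> nat \<Rightarrow> real) \<Rightarrow> real"
    and p :: real
  assumes "admissible a b"
    and "exponential_weights base_measure a b \<omega>"
    and "p > 0"
  shows "AE x in base_measure. \<exists>L::nat. L > 0 \<and>
    (\<forall>m\<ge>1. \<forall>n\<ge>1. m + n \<ge> L \<longrightarrow>
      last_passage (\<lambda>i j. \<omega> m n i j x) m n
        \<le> M_center a b m n + inverse (I_length a b m n) * real (m + n) powr (1/2 + p) \<and>
      last_passage (\<lambda>i j. \<omega> m n i j x) m n
        \<ge> M_center a b m n - inverse (I_length a b m n) * real (m + n) powr (9/10 + p))"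
proof -
  interpret P: prob_space base_measure by (rule prob_space_base_measure)
  \<comment> \<open>Half of \<open>p\<close> goes into the size of the deviations, the other half
    absorbs constants for large \<open>N\<close>.\<close>
  define e where "e = p / 2"
  have e: "e > 0" "p = 2 * e" using assms(3) by (auto simp: e_def)
  define h where "h N = 76 * exp (- (real N powr (1/2 + e)) / (8 * sqrt N))" for N
  define good where "good m n x \<longleftrightarrow>
      last_passage (\<lambda>i j. \<omega> m n i j x) m n
        \<le> M_center a b m n + inverse (I_length a b m n) * real (m + n) powr (1/2 + p) \<and>
      last_passage (\<lambda>i j. \<omega> m n i j x) m n
        \<ge> M_center a b m n - inverse (I_length a b m n) * real (m + n) powr (9/10 + p)" for m n x
  from eventually_conj[OF eventually_passage_estimates[OF e(1)] eventually_exit_estimate[OF e(1)]]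
  obtain N0 where N0: "\<And>N. N \<ge> N0 \<Longrightarrow> (real N powr (-1/10) \<le> 1/2 \<and>
    2 * real N powr (1/2 + e) \<le> real N powr (1/2 + p) \<and>
    7 * real N powr (1/2 + e) + 2 * real N powr (9/10 + e) + 3 * real N powr (1/10)
      + 2 * real N powr (-1/10) * real N \<le> real N powr (9/10 + p)) \<and>
    (2 * real N powr (-3/10) \<le> real N powr (-1/10) \<and>
    6 * real N powr (1/2 + e) + 4 * real N powr (-3/10) + 16 * (real N powr (-3/10))\<^sup>2 * real N powr (1/10) * real N
      \<le> real N powr (-3/10) * ((real N powr (9/10 + e))\<^sup>2 / real N))"
    unfolding eventually_sequentially e(2) by blast
  have "holds_except base_measure (h (m + n)) (good m n)" if mn: "m \<ge> 1" "n \<ge> 1" and "m + n \<ge> N0" for m n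
  proof -
    define N where "N = m + n"
    note N0' = N0[OF that(3), folded N_def]
    have adm: "0 < a m i + b n j" if "i \<in> {1..m}" "j \<in> {1..n}" for i j
      using assms(1) mn that by (simp add: admissible_def)
    have "I_length a b m n > 0"
    proof -
      have "row_min a m \<in> a m ` {1..m}" "row_min b n \<in> b n ` {1..n}"
        unfolding row_min_def using mn by (auto intro!: Min_in)
      then show ?thesis using adm by (auto simp: I_length_def)
    qed
    then have D: "0 \<le> inverse (I_length a b m n)" by simp
    have pos: "0 < real N powr (1/2 + e)" using mn by (simp add: N_def)
    have "holds_except (iid N) (h N)
      (\<lambda>x. lpp (bulk (stat_weight (a m) (b n) {1..m} {1..n} x)) N N
          \<le> M_center a b m n + inverse (I_length a b m n) * (2 * real N powr (1/2 + e)) \<and>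
        M_center a b m n - inverse (I_length a b m n) * (7 * real N powr (1/2 + e) + 2 * real N powr (9/10 + e)
            + 3 * real N powr (1/10) + 2 * real N powr (-1/10) * real N)
          \<le> lpp (bulk (stat_weight (a m) (b n) {1..m} {1..n} x)) N N)"
      unfolding h_def
      by (rule passage_bounds[where d = "real N powr (-3/10)"]) (use mn adm N_def N0' pos in auto)
    then have ev: "holds_except (iid N) (h N) (\<lambda>x. lpp (bulk (stat_weight (a m) (b n) {1..m} {1..n} x)) N N \<in>
        {M_center a b m n - inverse (I_length a b m n) * real N powr (9/10 + p)
         .. M_center a b m n + inverse (I_length a b m n) * real N powr (1/2 + p)})"
    proof (rule holds_except_mono, goal_cases)
      case (2 x)
      have "inverse (I_length a b m n) * (2 * real N powr (1/2 + e))
          \<le> inverse (I_length a b m n) * real N powr (1/2 + p)"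
        "inverse (I_length a b m n) * (7 * real N powr (1/2 + e) + 2 * real N powr (9/10 + e)
            + 3 * real N powr (1/10) + 2 * real N powr (-1/10) * real N)
          \<le> inverse (I_length a b m n) * real N powr (9/10 + p)"
        using N0' D by (auto intro!: mult_left_mono)
      then show ?case unfolding atLeastAtMost_iff using 2 by linarith
    qed simp
    show ?thesis
      using weights_transfer[OF assms(1,2) mn N_def ev borel_closed[OF closed_atLeastAtMost]]
      by (elim holds_except_mono) (auto simp: good_def N_def)
  qed
  then have "\<forall>m n. \<exists>B. m \<ge> 1 \<and> n \<ge> 1 \<and> m + n \<ge> N0 \<longrightarrow> B \<in> sets base_measure \<and>
      measure base_measure B \<le> h (m + n) \<and> (\<forall>x\<in>space base_measure. x \<notin> B \<longrightarrow> good m n x)"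
    unfolding holds_except_def by meson
  then obtain B where B: "\<And>m n. m \<ge> 1 \<Longrightarrow> n \<ge> 1 \<Longrightarrow> m + n \<ge> N0 \<Longrightarrow> B m n \<in> sets base_measure \<and>
      measure base_measure (B m n) \<le> h (m + n) \<and> (\<forall>x\<in>space base_measure. x \<notin> B m n \<longrightarrow> good m n x)"
    by metis
  \<comment> \<open>The exceptional sets of all rectangles with \<open>m + n = N\<close> are united;
    below \<open>N0\<close>, where \<open>B\<close> is not specified, the set is empty.\<close>
  define A where "A N = (if N \<ge> N0 then \<Union>m\<in>{1..<N}. B m (N - m) else {})" for N
  have A_sets: "A N \<in> sets base_measure" for N
    using B by (auto simp: A_def intro!: sets.finite_UN)
  have A_le: "measure base_measure (A N) \<le> real N * h N" for N
  proof (cases "N \<ge> N0")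
    case True
    have "measure base_measure (A N) \<le> (\<Sum>m\<in>{1..<N}. measure base_measure (B m (N - m)))"
      unfolding A_def using True B by (auto intro!: P.finite_measure_subadditive_finite)
    also have "\<dots> \<le> (\<Sum>m\<in>{1..<N}. h N)"
    proof (rule sum_mono)
      fix m assume "m \<in> {1..<N}"
      then have "1 \<le> m" "1 \<le> N - m" "m + (N - m) = N" by auto
      with B[of m "N - m"] True show "measure base_measure (B m (N - m)) \<le> h N"
        by simp
    qed
    also have "\<dots> = real (N - 1) * h N" by simp
    also have "\<dots> \<le> real N * h N" by (intro mult_right_mono) (auto simp: h_def)
    finally show ?thesis .
  next
    case False
    then show ?thesis by (simp add: A_def h_def)
  qed
  have "summable (\<lambda>N. measure base_measure (A N))"
  proof (rule summable_comparison_test'[of "\<lambda>N. real N * h N" 0])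
    show "summable (\<lambda>N. real N * h N)" unfolding h_def by (rule summable_tail[OF e(1)])
    show "norm (measure base_measure (A N)) \<le> real N * h N" for N using A_le[of N] by simp
  qed
  \<comment> \<open>Borel-Cantelli: almost every \<open>x\<close> lies in only finitely many of the
    sets \<open>A N\<close>, which bounds the random \<open>L\<close>.\<close>
  from borel_cantelli_AE1[OF A_sets _ this]
  have "AE x in base_measure. \<forall>\<^sub>F N in sequentially. x \<in> space base_measure - A N"
    by (simp add: P.emeasure_eq_measure)
  then show ?thesis
    unfolding good_def[symmetric]
  proof (eventually_elim)
    case (elim x)
    then obtain N1 where N1: "\<And>N. N \<ge> N1 \<Longrightarrow> x \<in> space base_measure - A N"
      unfolding eventually_sequentially by blast
    \<comment> \<open>The maximum with \<open>N0\<close> keeps to rectangles for which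
      \<open>B\<close> is specified, and \<open>Suc\<close> makes the witness for \<open>L\<close>
      positive.\<close>
    have "good m n x" if "m \<ge> 1" "n \<ge> 1" "m + n \<ge> Suc (max N0 N1)" for m n
    proof -
      have "x \<in> space base_measure" "x \<notin> A (m + n)" using N1[of "m + n"] that by auto
      moreover have "B m n \<subseteq> A (m + n)"
        using that unfolding A_def by (auto intro!: bexI[of _ m])
      moreover have "N0 \<le> m + n" using that(3) by simp
      ultimately show ?thesis using B[of m n] that(1,2) by blast
    qed
    then show ?case by (intro exI[of _ "Suc (max N0 N1)"]) auto
  qed
qed

end
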